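(* Let $k$ be an even integer and let $T$ be an element of the Hecke algebra $\mathcal{H}$. Then for all $Z\in\mathbb{H}_2$ and all $s\in\mathbb{C}$ with $2\,\mathrm{Re}(s)+k>3$, $$\left(E_k^{(2)}\big|_k\bowtie T\right)(Z,s)=0,$$ that is, $\left(E_k^{(2)}|_k\widetilde{T}^{\bullet}\right)(Z,s)=\left(E_k^{(2)}|_k\widetilde{T}_{\bullet}\right)(Z,s)$.
   Context: $\mathbb{H}_2$ is the Siegel upper half-space of degree $2$. $\mathrm{Sp}_2(\mathbb{R})$ (symplectic $4\times4$ matrices $g=\begin{pmatrix} A & B \\ C & D \end{pmatrix}$ in $2\times 2$ blocks) acts by $g(Z)=(AZ+B)(CZ+D)^{-1}$; $j(g,Z)=\det(CZ+D)$; $\delta(Z)=\det(\mathrm{Im}\,Z)$. $\Gamma_2=\mathrm{Sp}_2(\mathbb{Z})$, $\Gamma_{2,0}\subset\Gamma_2$ is the subgroup with $C=0$, and for $k$ even, $2\,\mathrm{Re}(s)+k>3$, $$E_k^{(2)}(Z,s)=\sum_{g\in\Gamma_{2,0}\backslash\Gamma_2}j(g,Z)^{-k}\,\delta(g(Z))^{s}$$ (absolutely and locally uniformly convergent). Slash operator: $(F|_kg)(Z)=j(g,Z)^{-k}F(g(Z))$ for $g\in\mathrm{Sp}_2(\mathbb{R})$; $s$ is a fixed parameter. Hecke algebra: $\Gamma=\mathrm{SL}_2(\mathbb{Z})$, and $M(l)$ is the set of integral $2\times2$ matrices of determinant $l\ge 1$; $M_\infty=\bigcup_{l,n\ge1}\begin{pmatrix}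 n^{-1} & 0 \\ 0 & n^{-1} \end{pmatrix}M(l)=\mathrm{GL}_2^+(\mathbb{Q})$. $\mathcal{H}$ is the Hecke algebra over $\mathbb{Q}$ of the Hecke pair $(\Gamma,M_\infty)$: finite formal sums $T=\sum_ja_j\Gamma t_j$ ($a_j\in\mathbb{Q}$, $t_j\in M_\infty$) of left cosets, invariant under right multiplication by $\Gamma$, with product $(\sum_i a_i\Gamma g_i)(\sum_j b_j\Gamma h_j)=\sum_{i,j}a_ib_j\Gamma g_ih_j$. Embeddings: for $A=\begin{pmatrix} a & b \\ c & d \end{pmatrix}$, $B=\begin{pmatrix} e & f \\ g & h \end{pmatrix}$ in $\mathrm{SL}_2(\mathbb{R})$ put $$A\times B=\begin{pmatrix} a & 0 & b & 0 \\ 0 & e & 0 & f \\ c & 0 & d & 0 \\ 0 & g & 0 & h \end{pmatrix}\in\mathrm{Sp}_2(\mathbb{R}),\qquad A^\bullet=A\times 1_2,\quad A_\bullet=1_2\times A.$$ For $M\in\mathrm{GL}_2^+(\mathbb{R})$ put $\widetilde M=\det(M)^{-1/2}M$, $\widetilde M^\bullet=(\widetilde M)^\bullet$, $\widetilde M_\bullet=(\widetilde M)_\bullet$. For $T=\sum_ja_j\Gamma t_j\in\mathcal{H}$ and $F:\mathbb{H}_2\to\mathbb{C}$ with $F|_k\gamma^\bullet=F|_k\gamma_\bullet=F$ for all $\gamma\in\Gamma$ put $$F|_k\widetilde T^\bullet=\sum_ja_j\,F|_k\widetilde{t_j}^\bullet,\qquad F|_k\widetilde T_\bullet=\sum_ja_j\,F|_k\widetilde{t_j}_\bullet,\qquad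 F|_k\bowtie T=F|_k\widetilde T^\bullet-F|_k\widetilde T_\bullet .$$ *)

theory Defs
  imports "HOL-Analysis.Analysis" "HOL-Library.Poly_Mapping" "HOL-Algebra.Module"
begin

(* A 4 x 4 matrix is indexed by the sum type 2 + 2, ordered Inl 1, Inl 2, Inr 1, Inr 2,
   so that Inl / Inr address its 2 x 2 blocks. *)

definition block_matrix ::
  "'a^2^2 \<Rightarrow> 'a^2^2 \<Rightarrow> 'a^2^2 \<Rightarrow> 'a^2^2 \<Rightarrow> 'a^(2 + 2)^(2 + 2)"
  where "block_matrix A B C D = (\<chi> i j.
    (case i of
       Inl p \<Rightarrow> (case j of Inl q \<Rightarrow> A $ p $ q | Inr q \<Rightarrow> B $ p $ q)
     | Inr p \<Rightarrow> (case j of Inl q \<Rightarrow> C $ p $ q | Inr q \<Rightarrow> D $ p $ q)))"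

definition block_A :: "'a^(2 + 2)^(2 + 2) \<Rightarrow> 'a^2^2"
  where "block_A g = (\<chi> p q. g $ Inl p $ Inl q)"

definition block_B :: "'a^(2 + 2)^(2 + 2) \<Rightarrow> 'a^2^2"
  where "block_B g = (\<chi> p q. g $ Inl p $ Inr q)"

definition block_C :: "'a^(2 + 2)^(2 + 2) \<Rightarrow> 'a^2^2"
  where "block_C g = (\<chi> p q. g $ Inr p $ Inl q)"

definition block_D :: "'a^(2 + 2)^(2 + 2) \<Rightarrow> 'a^2^2"
  where "block_D g = (\<chi> p q. g $ Inr p $ Inr q)"

definition integral_matrix :: "real^'n^'m \<Rightarrow> bool"
  where "integral_matrix M \<longleftrightarrow> (\<forall>i j. M $ i $ j \<in> \<int>)"

definition positive_definite :: "real^'n^'n \<Rightarrow> bool"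
  where "positive_definite Y \<longleftrightarrow> transpose Y = Y \<and> (\<forall>x. x \<noteq> 0 \<longrightarrow> x \<bullet> (Y *v x) > 0)"

definition siegel_H2 :: "(complex^2^2) set"
  where "siegel_H2 = {Z. transpose Z = Z \<and> positive_definite (map_matrix Im Z)}"

definition symplectic_form :: "real^(2 + 2)^(2 + 2)"
  where "symplectic_form = block_matrix 0 (mat 1) (- mat 1) 0"

definition Sp2_R :: "(real^(2 + 2)^(2 + 2)) set"
  where "Sp2_R = {g. transpose g ** symplectic_form ** g = symplectic_form}"

definition Sp2_Z :: "(real^(2 + 2)^(2 + 2)) set"
  where "Sp2_Z = {g \<in> Sp2_R. integral_matrix g}"

definition Sp2_Z0 :: "(real^(2 + 2)^(2 + 2)) set"
  where "Sp2_Z0 = {g \<in> Sp2_Z. block_C g = 0}"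

definition sp_denom :: "real^(2 + 2)^(2 + 2) \<Rightarrow> complex^2^2 \<Rightarrow> complex^2^2"
  where "sp_denom g Z =
    map_matrix complex_of_real (block_C g) ** Z + map_matrix complex_of_real (block_D g)"

definition sp_act :: "real^(2 + 2)^(2 + 2) \<Rightarrow> complex^2^2 \<Rightarrow> complex^2^2"
  where "sp_act g Z =
    (map_matrix complex_of_real (block_A g) ** Z + map_matrix complex_of_real (block_B g))
      ** matrix_inv (sp_denom g Z)"

definition aut_factor :: "real^(2 + 2)^(2 + 2) \<Rightarrow> complex^2^2 \<Rightarrow> complex"
  where "aut_factor g Z = det (sp_denom g Z)"

definition im_det :: "complex^2^2 \<Rightarrow> real"
  where "im_det Z = det (map_matrix Im Z)"

definition slash ::
  "int \<Rightarrow> (complex^2^2 \<Rightarrow> complex) \<Rightarrow> real^(2 + 2)^(2 + 2) \<Rightarrow> complex^2^2 \<Rightarrow> complex"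
  where "slash k F g Z = aut_factor g Z powi (- k) * F (sp_act g Z)"

(* left_cosets G M is the set G \ M of cosets G t with t in M. *)
definition left_cosets :: "(real^'n^'n) set \<Rightarrow> (real^'n^'n) set \<Rightarrow> (real^'n^'n) set set"
  where "left_cosets G M = (\<lambda>t. (\<lambda>\<gamma>. \<gamma> ** t) ` G) ` M"

definition coset_rep :: "(real^'n^'n) set \<Rightarrow> real^'n^'n"
  where "coset_rep c = (SOME t. t \<in> c)"

(* For even k the summand depends only on the coset: elements of Sp2_Z0 have det D = 1 or -1. *)
definition eisenstein :: "int \<Rightarrow> complex \<Rightarrow> complex^2^2 \<Rightarrow> complex"
  where "eisenstein k s Z =
    (\<Sum>\<^sub>\<infinity>c\<in>left_cosets Sp2_Z0 Sp2_Z.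
       aut_factor (coset_rep c) Z powi (- k)
         * complex_of_real (im_det (sp_act (coset_rep c) Z)) powr s)"

definition int_mats_det :: "nat \<Rightarrow> (real^2^2) set"
  where "int_mats_det l = {m. integral_matrix m \<and> det m = real l}"

definition SL2_Z :: "(real^2^2) set"
  where "SL2_Z = int_mats_det 1"

definition M_infty :: "(real^2^2) set"
  where "M_infty = (\<Union>l\<in>{1..}. \<Union>n\<in>{1..}. (\<lambda>m. mat (1 / real n) ** m) ` int_mats_det l)"

(* Formal rational combinations of left cosets are finitely supported functions on cosets.
   In the product, the coset (Gamma g) h does not depend on the choice of g in its coset, and the
   sum does not depend on the choice of h because T is invariant. *)

type_synonym formal_coset_sum = "(real^2^2) set \<Rightarrow>\<^sub>0 rat"

definition hecke_algebra :: "(rat, formal_coset_sum) module"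
  where "hecke_algebra =
    \<lparr> carrier = {T. Poly_Mapping.keys T \<subseteq> left_cosets SL2_Z M_infty \<and>
        (\<forall>\<gamma>\<in>SL2_Z. \<forall>c\<in>left_cosets SL2_Z M_infty.
           Poly_Mapping.lookup T ((\<lambda>t. t ** \<gamma>) ` c) = Poly_Mapping.lookup T c)},
      mult = (\<lambda>T U. \<Sum>c\<in>Poly_Mapping.keys T. \<Sum>d\<in>Poly_Mapping.keys U.
        Poly_Mapping.single ((\<lambda>g. g ** coset_rep d) ` c)
          (Poly_Mapping.lookup T c * Poly_Mapping.lookup U d)),
      one = Poly_Mapping.single SL2_Z 1,
      zero = 0,
      add = (+),
      smult = (\<lambda>a T. Poly_Mapping.map ((*) a) T) \<rparr>"

definition diag2 :: "'a::zero \<Rightarrow> 'a \<Rightarrow> 'a^2^2"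
  where "diag2 x y = vector [vector [x, 0], vector [0, y]]"

definition sp_times :: "real^2^2 \<Rightarrow> real^2^2 \<Rightarrow> real^(2 + 2)^(2 + 2)"
  where "sp_times A B = block_matrix
    (diag2 (A $ 1 $ 1) (B $ 1 $ 1)) (diag2 (A $ 1 $ 2) (B $ 1 $ 2))
    (diag2 (A $ 2 $ 1) (B $ 2 $ 1)) (diag2 (A $ 2 $ 2) (B $ 2 $ 2))"

definition up_bullet :: "real^2^2 \<Rightarrow> real^(2 + 2)^(2 + 2)"
  where "up_bullet A = sp_times A (mat 1)"

definition down_bullet :: "real^2^2 \<Rightarrow> real^(2 + 2)^(2 + 2)"
  where "down_bullet A = sp_times (mat 1) A"

definition normalize_det :: "real^2^2 \<Rightarrow> real^2^2"
  where "normalize_det M = (det M powr (- 1 / 2)) *\<^sub>R M"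

(* The next two definitions are independent of the chosen coset representatives for F invariant
   under the images of SL2_Z under both embeddings. *)

definition hecke_up ::
  "int \<Rightarrow> (complex^2^2 \<Rightarrow> complex) \<Rightarrow> formal_coset_sum \<Rightarrow> complex^2^2 \<Rightarrow> complex"
  where "hecke_up k F T Z = (\<Sum>c\<in>Poly_Mapping.keys T.
    of_rat (Poly_Mapping.lookup T c) * slash k F (up_bullet (normalize_det (coset_rep c))) Z)"

definition hecke_down ::
  "int \<Rightarrow> (complex^2^2 \<Rightarrow> complex) \<Rightarrow> formal_coset_sum \<Rightarrow> complex^2^2 \<Rightarrow> complex"
  where "hecke_down k F T Z = (\<Sum>c\<in>Poly_Mapping.keys T.
    of_rat (Poly_Mapping.lookup T c) * slash k F (down_bullet (normalize_det (coset_rep c))) Z)"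

definition bowtie ::
  "int \<Rightarrow> (complex^2^2 \<Rightarrow> complex) \<Rightarrow> formal_coset_sum \<Rightarrow> complex^2^2 \<Rightarrow> complex"
  where "bowtie k F T Z = hecke_up k F T Z - hecke_down k F T Z"

end

theory Submission
  imports Defs
begin

text \<open>
  Slashed by \<open>h\<close>, the Eisenstein series becomes a sum over the real Lagrangian planes \<open>L\<close> that are
  rational for the lattice \<open>\<int>\<^sup>4 h\<close>, where the term of \<open>L\<close> depends only on the covolume of
  \<open>L \<inter> \<int>\<^sup>4 h\<close>. The lattices of \<open>up_bullet\<close> and \<open>down_bullet\<close> of the same matrix are exchanged by the
  swap of the two planes. By the elementary divisor theorem the swap moves a Lagrangian that is
  rational for one of them as some pair \<open>(\<gamma>, \<delta>)\<close> of elements of \<open>SL2_Z\<close> does. Here \<open>\<gamma>\<close> preserves the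
  lattice and \<open>\<delta>\<close> permutes the cosets in \<open>T\<close>, so the two sums agree for each Lagrangian separately.
  Convergence only serves to exchange the sum over the cosets of \<open>T\<close> with that over \<open>L\<close>. It does
  not depend on \<open>h\<close>, because the automorphy factors of \<open>g\<close> and \<open>g ** h\<close> have bounded ratio on
  \<open>Sp2_R\<close>; and if the series diverges, every \<open>infsum\<close> involved is \<open>0\<close>.
\<close>

section \<open>Block matrices\<close>

text \<open>After normalisation by \<open>det M powr (- 1 / 2)\<close> the matrices need not be
  rational, and the lattices of different cosets of \<open>T\<close> need not be commensurable.
  Their rational Lagrangians do not lie in one rational index set, which is why the sums run over
  all real planes, with weight \<open>0\<close> for a plane that is not rational. What makes the
  swap act through \<open>SL2_Z\<close> is a sign. The symplectic form restricts to the area form on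
  each of the two planes, so a Lagrangian that is a graph belongs to a map of determinant -1. The
  elementary divisor theorem makes this map diagonal, D = diag(x, y) with xy = -1. The swap replaces
  D by its inverse diag(-y, -x), and this equals w D w for the quarter turn w with rows (0, 1) and
  (-1, 0). The remaining Lagrangians are sums of a line in each plane, and \<open>SL2_Z\<close> is
  transitive on rational lines. The pair (\<gamma>, \<delta>) depends on the Lagrangian alone and
  not on the coset, so one translation of the cosets of \<open>T\<close> serves all its terms at
  once. Bases are compared only up to |det|, which suffices because \<open>k\<close> is
  even.\<close>

lemma sum_plus_index:
  fixes f :: "'a::finite + 'b::finite \<Rightarrow> 'c::comm_monoid_add"
  shows "(\<Sum>i\<in>UNIV. f i) = (\<Sum>p\<in>UNIV. f (Inl p)) + (\<Sum>q\<in>UNIV. f (Inr q))"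
  by (subst UNIV_Plus_UNIV [symmetric], subst sum.Plus) auto

lemma vec_plus_index_eq_iff:
  "(x :: 'c^('a::finite + 'b::finite)) = y \<longleftrightarrow>
     (\<forall>p. x $ Inl p = y $ Inl p) \<and> (\<forall>q. x $ Inr q = y $ Inr q)"
  by (metis vec_eq_iff obj_sumE)

definition beside :: "'a^2^2 \<Rightarrow> 'a^2^2 \<Rightarrow> 'a^(2 + 2)^2"
  where "beside C D = (\<chi> i j. case j of Inl q \<Rightarrow> C $ i $ q | Inr q \<Rightarrow> D $ i $ q)"

definition left_half :: "'a^(2 + 2)^2 \<Rightarrow> 'a^2^2"
  where "left_half P = (\<chi> i q. P $ i $ Inl q)"

definition right_half :: "'a^(2 + 2)^2 \<Rightarrow> 'a^2^2"
  where "right_half P = (\<chi> i q. P $ i $ Inr q)"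

text \<open>The rows span the Lagrangian plane attached to \<open>g\<close>: right multiplication
  moves this plane, and left multiplication by an element of \<open>Sp2_Z0\<close> only changes its
  basis. The automorphy factor depends on nothing else of \<open>g\<close>.\<close>

definition lower_half :: "'a^(2 + 2)^(2 + 2) \<Rightarrow> 'a^(2 + 2)^2"
  where "lower_half g = beside (block_C g) (block_D g)"

lemma block_of_block_matrix [simp]:
  "block_A (block_matrix A B C D) = A" "block_B (block_matrix A B C D) = B"
  "block_C (block_matrix A B C D) = C" "block_D (block_matrix A B C D) = D"
  by (simp_all add: block_matrix_def block_A_def block_B_def block_C_def block_D_def vec_eq_iff)

lemma block_matrix_collapse [simp]:
  "block_matrix (block_A g) (block_B g) (block_C g) (block_D g) = g"
  by (simp add: block_matrix_def block_A_def block_B_def block_C_def block_D_def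
      vec_plus_index_eq_iff)

lemma block_matrix_eq_iff [simp]:
  "block_matrix A B C D = block_matrix A' B' C' D' \<longleftrightarrow> A = A' \<and> B = B' \<and> C = C' \<and> D = D'"
  by (metis block_of_block_matrix)

lemma block_matrix_cases [case_names blocks]:
  obtains A B C D where "g = block_matrix A B C D"
  by (metis block_matrix_collapse)

lemma left_right_beside [simp]: "left_half (beside C D) = C" "right_half (beside C D) = D"
  by (simp_all add: beside_def left_half_def right_half_def vec_eq_iff)

lemma beside_collapse [simp]: "beside (left_half P) (right_half P) = P"
  by (simp add: beside_def left_half_def right_half_def vec_plus_index_eq_iff vec_eq_iff)

lemma beside_eq_iff [simp]: "beside C D = beside C' D' \<longleftrightarrow> C = C' \<and> D = D'"
  by (metis left_right_beside)

lemma lower_half_block_matrix [simp]: "lower_half (block_matrix A B C D) = beside C D"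
  by (simp add: lower_half_def)

lemma block_matrix_mult:
  fixes A :: "'a::semiring_1^2^2"
  shows "block_matrix A B C D ** block_matrix A' B' C' D' =
    block_matrix (A ** A' + B ** C') (A ** B' + B ** D') (C ** A' + D ** C') (C ** B' + D ** D')"
  by (simp add: block_matrix_def matrix_matrix_mult_def vec_plus_index_eq_iff sum_plus_index)

lemma beside_mult_block_matrix:
  fixes C :: "'a::semiring_1^2^2"
  shows "beside C D ** block_matrix A' B' C' D' = beside (C ** A' + D ** C') (C ** B' + D ** D')"
  by (simp add: block_matrix_def beside_def matrix_matrix_mult_def vec_plus_index_eq_iff
      sum_plus_index vec_eq_iff split: sum.split)

lemma mult_beside:
  fixes C :: "'a::semiring_1^2^2"
  shows "A ** beside C D = beside (A ** C) (A ** D)"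
  by (simp add: beside_def matrix_matrix_mult_def vec_eq_iff split: sum.split)

lemma block_matrix_transpose:
  "transpose (block_matrix A B C D) =
    block_matrix (transpose A) (transpose C) (transpose B) (transpose D)"
  by (simp add: block_matrix_def transpose_def vec_plus_index_eq_iff)

lemma mat_1_block: "(mat 1 :: 'a::semiring_1^(2+2)^(2+2)) = block_matrix (mat 1) 0 0 (mat 1)"
  by (simp add: block_matrix_def mat_def vec_plus_index_eq_iff)

lemma lower_half_mult:
  fixes g h :: "'a::semiring_1^(2+2)^(2+2)"
  shows "lower_half (g ** h) = lower_half g ** h"
  by (cases g rule: block_matrix_cases; cases h rule: block_matrix_cases)
    (simp add: block_matrix_mult beside_mult_block_matrix)

section \<open>Two by two matrices through their entries\<close>

definition mat2 :: "'a \<Rightarrow> 'a \<Rightarrow> 'a \<Rightarrow> 'a \<Rightarrow> 'a::zero^2^2"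
  where "mat2 a b c d = vector [vector [a, b], vector [c, d]]"

lemma mat2_nth [simp]:
  "mat2 a b c d $ 1 $ 1 = a" "mat2 a b c d $ 1 $ 2 = b"
  "mat2 a b c d $ 2 $ 1 = c" "mat2 a b c d $ 2 $ 2 = d"
  by (simp_all add: mat2_def)

lemma mat2_collapse: "mat2 (M $ 1 $ 1) (M $ 1 $ 2) (M $ 2 $ 1) (M $ 2 $ 2) = M"
  by (simp add: vec_eq_iff forall_2)

lemma mat2_eq_iff [simp]:
  "mat2 a b c d = mat2 a' b' c' d' \<longleftrightarrow> a = a' \<and> b = b' \<and> c = c' \<and> d = d'"
  by (metis mat2_nth)

lemma mat2_cases [case_names mat2]:
  obtains a b c d where "M = mat2 a b c d"
  by (metis mat2_collapse)

lemma mat2_mult [simp]: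
  fixes a :: "'a::semiring_1"
  shows "mat2 a b c d ** mat2 a' b' c' d' =
    mat2 (a * a' + b * c') (a * b' + b * d') (c * a' + d * c') (c * b' + d * d')"
  by (simp add: matrix_matrix_mult_def vec_eq_iff forall_2 sum_2)

lemma mat2_det [simp]: "det (mat2 a b c d) = a * d - b * c"
  by (simp add: det_2)

lemma mat2_transpose [simp]: "transpose (mat2 a b c d) = mat2 a c b d"
  by (simp add: transpose_def vec_eq_iff forall_2)

lemma mat2_scaleR [simp]: "r *\<^sub>R mat2 a b c d = mat2 (r *\<^sub>R a) (r *\<^sub>R b) (r *\<^sub>R c) (r *\<^sub>R d)"
  by (simp add: vec_eq_iff forall_2)

lemma mat2_add [simp]:
  "mat2 a b c d + mat2 a' b' c' d' = mat2 (a + a' :: 'a::monoid_add) (b + b') (c + c') (d + d')"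
  by (simp add: vec_eq_iff forall_2)

lemma mat2_uminus [simp]:
  "- mat2 a b c d = mat2 (- a :: 'a::group_add) (- b) (- c) (- d)"
  by (simp add: vec_eq_iff forall_2)

lemma mat_eq_mat2: "mat x = mat2 x 0 0 x"
  by (simp add: mat_def vec_eq_iff forall_2)

lemma zero_eq_mat2: "0 = mat2 0 0 0 0"
  by (simp add: vec_eq_iff forall_2)

lemma diag2_eq_mat2: "diag2 x y = mat2 x 0 0 y"
  by (simp add: diag2_def mat2_def)

lemma integral_mat2 [simp]:
  "integral_matrix (mat2 a b c d) \<longleftrightarrow> a \<in> \<int> \<and> b \<in> \<int> \<and> c \<in> \<int> \<and> d \<in> \<int>"
  by (auto simp: integral_matrix_def forall_2)

lemma integral_block_matrix [simp]:
  "integral_matrix (block_matrix A B C D) \<longleftrightarrow>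
     integral_matrix A \<and> integral_matrix B \<and> integral_matrix C \<and> integral_matrix D"
proof -
  have *: "(\<forall>i::2+2. Q i) \<longleftrightarrow> (\<forall>p. Q (Inl p)) \<and> (\<forall>q. Q (Inr q))" for Q
    by (metis obj_sumE)
  show ?thesis
    by (auto simp: integral_matrix_def block_matrix_def *)
qed

lemma integral_matrix_mult:
  "integral_matrix A \<Longrightarrow> integral_matrix B \<Longrightarrow> integral_matrix (A ** B)"
  by (auto simp: integral_matrix_def matrix_matrix_mult_def intro!: Ints_sum Ints_mult)

lemma integral_matrix_transpose: "integral_matrix (transpose A) \<longleftrightarrow> integral_matrix A"
  by (auto simp: integral_matrix_def transpose_def)

lemma integral_matrix_uminus: "integral_matrix (- A) \<longleftrightarrow> integral_matrix A"
  by (auto simp: integral_matrix_def minus_in_Ints_iff)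

lemma integral_matrix_mat: "integral_matrix (mat 1)" "integral_matrix 0"
  by (auto simp: integral_matrix_def mat_def)

lemma matrix_mult_uminus:
  fixes A :: "'a::comm_ring_1^'n^'m"
  shows "(- A) ** B = - (A ** B)" "A ** (- B) = - (A ** B)"
  by (simp_all add: matrix_matrix_mult_def vec_eq_iff sum_negf)

lemma matrix_mult_0 [simp]:
  fixes A :: "'a::semiring_1^'n^'m" and B :: "'a^'k^'n"
  shows "0 ** B = 0" "A ** 0 = 0"
  by (simp_all add: matrix_matrix_mult_def vec_eq_iff)

lemma matrix_distribs:
  fixes A :: "'a::comm_ring_1^'n^'m"
  shows "(A + B) ** C = A ** C + B ** C" "(A - B) ** C = A ** C - B ** C"
    "A ** (X - Y) = A ** X - A ** Y" "A ** (X + Y) = A ** X + A ** Y"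
  by (simp_all add: matrix_matrix_mult_def vec_eq_iff sum.distrib sum_subtractf algebra_simps)

lemma det_mult_eq_1D: "(A :: 'a::field^'n^'n) ** B = mat 1 \<Longrightarrow> det A \<noteq> 0"
  by (metis det_I det_mul mult_zero_left zero_neq_one)

lemma det_nonzero_inverse:
  fixes A :: "'a::field^'n^'n"
  assumes "det A \<noteq> 0"
  obtains B where "A ** B = mat 1" "B ** A = mat 1" "det B = inverse (det A)"
proof -
  obtain B where B: "A ** B = mat 1" "B ** A = mat 1"
    using assms invertible_det_nz invertible_def by metis
  then have "det A * det B = 1"
    by (metis det_I det_mul)
  then show thesis
    using that B assms by (simp add: field_simps)
qed

section \<open>The symplectic group\<close>

lemma symplectic_form_sq: "symplectic_form ** symplectic_form = - mat 1"
  by (simp add: symplectic_form_def block_matrix_mult mat_1_block matrix_mult_uminus)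
    (simp add: block_matrix_def vec_eq_iff split: sum.split)

text \<open>Multiplying the defining relation on the left by the form J, whose square is -1,
  exhibits the inverse. Being polynomial in the entries of \<open>g\<close>, it is integral together
  with \<open>g\<close>, which gives inverses in \<open>Sp2_Z\<close>.\<close>

lemma Sp2_R_inverse:
  assumes "g \<in> Sp2_R"
  defines "g' \<equiv> - (symplectic_form ** transpose g ** symplectic_form)"
  shows "g' ** g = mat 1" "g ** g' = mat 1"
proof -
  let ?J = "symplectic_form"
  have "?J ** (transpose g ** ?J ** g) = ?J ** ?J"
    using assms by (simp add: Sp2_R_def)
  then show 1: "g' ** g = mat 1"
    by (simp add: g'_def matrix_mult_uminus symplectic_form_sq matrix_mul_assoc)
  then show "g ** g' = mat 1"
    using matrix_left_right_inverse by blast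
qed

text \<open>The definition constrains columns; this version constrains rows, as needed to read the
  lower half as a basis of a Lagrangian.\<close>

lemma Sp2_R_iff_transpose: "g \<in> Sp2_R \<longleftrightarrow> g ** symplectic_form ** transpose g = symplectic_form"
proof -
  let ?J = "symplectic_form"
  have *: "g ** ?J ** transpose g = ?J" if "transpose g ** ?J ** g = ?J" for g
  proof -
    have g: "g \<in> Sp2_R" using that by (simp add: Sp2_R_def)
    have "g ** (- (?J ** transpose g ** ?J)) ** ?J = ?J"
      using Sp2_R_inverse(2)[OF g] by simp
    moreover have "g ** (- (?J ** transpose g ** ?J)) ** ?J = - (g ** ?J ** transpose g ** (?J ** ?J))"
      by (simp add: matrix_mult_uminus matrix_mul_assoc)
    ultimately show ?thesis
      by (simp add: symplectic_form_sq matrix_mult_uminus)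
  qed
  show ?thesis
    using *[of g] *[of "transpose g"] by (auto simp: Sp2_R_def)
qed

lemma Sp2_R_mult: "g \<in> Sp2_R \<Longrightarrow> h \<in> Sp2_R \<Longrightarrow> g ** h \<in> Sp2_R"
  by (simp add: Sp2_R_def matrix_transpose_mul)
    (metis matrix_mul_assoc)

lemma mat_1_in_Sp2_R: "mat 1 \<in> Sp2_R"
  by (simp add: Sp2_R_def)

lemma Sp2_R_has_inverse:
  assumes "g \<in> Sp2_R"
  obtains g' where "g' \<in> Sp2_R" "g' ** g = mat 1" "g ** g' = mat 1"
proof
  let ?J = "symplectic_form"
  let ?g = "- (?J ** transpose g ** ?J)"
  show 1: "?g ** g = mat 1" "g ** ?g = mat 1"
    using Sp2_R_inverse assms by auto
  have "transpose ?g ** ?J ** ?g = transpose ?g ** (transpose g ** ?J ** g) ** ?g"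
    using assms by (simp add: Sp2_R_def)
  also have "\<dots> = transpose (g ** ?g) ** ?J ** (g ** ?g)"
    by (simp add: matrix_transpose_mul matrix_mul_assoc)
  finally show "?g \<in> Sp2_R"
    by (simp add: Sp2_R_def 1)
qed

lemma integral_symplectic_form: "integral_matrix symplectic_form"
  by (simp add: symplectic_form_def integral_matrix_uminus integral_matrix_mat)

lemma Sp2_Z_mult: "g \<in> Sp2_Z \<Longrightarrow> h \<in> Sp2_Z \<Longrightarrow> g ** h \<in> Sp2_Z"
  by (simp add: Sp2_Z_def Sp2_R_mult integral_matrix_mult)

lemma mat_1_in_Sp2_Z: "mat 1 \<in> Sp2_Z"
  by (simp add: Sp2_Z_def mat_1_in_Sp2_R integral_matrix_mat)

lemma Sp2_Z_has_inverse:
  assumes "g \<in> Sp2_Z"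
  obtains g' where "g' \<in> Sp2_Z" "g' ** g = mat 1" "g ** g' = mat 1"
proof -
  have g: "g \<in> Sp2_R" and i: "integral_matrix g"
    using assms by (auto simp: Sp2_Z_def)
  obtain g' where g': "g' \<in> Sp2_R" "g' ** g = mat 1" "g ** g' = mat 1"
    using Sp2_R_has_inverse[OF g] .
  have "g' = g' ** (g ** - (symplectic_form ** transpose g ** symplectic_form))"
    using Sp2_R_inverse(2)[OF g] by simp
  also have "\<dots> = - (symplectic_form ** transpose g ** symplectic_form)"
    by (simp add: matrix_mul_assoc g')
  finally have "integral_matrix g'"
    using i by (simp add: integral_matrix_uminus integral_matrix_mult integral_symplectic_form
        integral_matrix_transpose)
  then show thesis
    using g' that by (auto simp: Sp2_Z_def)
qed

lemma block_matrix_in_Sp2_R_iff: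
  "block_matrix A B C D \<in> Sp2_R \<longleftrightarrow>
     A ** transpose B = B ** transpose A \<and> C ** transpose D = D ** transpose C \<and>
     A ** transpose D - B ** transpose C = mat 1"
proof -
  have 1: "A ** transpose D - B ** transpose C = mat 1 \<longleftrightarrow>
    D ** transpose A - C ** transpose B = mat 1"
  proof -
    have "transpose (A ** transpose D - B ** transpose C) = D ** transpose A - C ** transpose B"
      using matrix_transpose_mul[of A "transpose D"] matrix_transpose_mul[of B "transpose C"]
      by (simp add: vec_eq_iff transpose_def)
    then show ?thesis
      by (metis transpose_mat transpose_transpose)
  qed
  have 2: "block_matrix A B C D ** symplectic_form ** transpose (block_matrix A B C D) =
    block_matrix (A ** transpose B - B ** transpose A) (A ** transpose D - B ** transpose C)
      (C ** transpose B - D ** transpose A) (C ** transpose D - D ** transpose C)"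
    by (simp add: block_matrix_transpose symplectic_form_def block_matrix_mult matrix_mult_uminus)
  have 3: "C ** transpose B - D ** transpose A = - mat 1 \<longleftrightarrow>
    D ** transpose A - C ** transpose B = mat 1"
    by (metis minus_diff_eq minus_minus)
  show ?thesis
    unfolding Sp2_R_iff_transpose 2 unfolding symplectic_form_def block_matrix_eq_iff
    using 1 3 by auto
qed

section \<open>The embeddings of pairs of two by two matrices\<close>

text \<open>In the rows of a two by four matrix, \<open>sp_times\<close> acts separately on the
  columns 1, 3 and on the columns 2, 4.\<close>

definition interleave :: "'a::zero^2^2 \<Rightarrow> 'a^2^2 \<Rightarrow> 'a^(2 + 2)^2"
  where "interleave P Q = beside
    (mat2 (P $ 1 $ 1) (Q $ 1 $ 1) (P $ 2 $ 1) (Q $ 2 $ 1))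
    (mat2 (P $ 1 $ 2) (Q $ 1 $ 2) (P $ 2 $ 2) (Q $ 2 $ 2))"

definition swap_planes :: "real^(2 + 2)^(2 + 2)"
  where "swap_planes = block_matrix (mat2 0 1 1 0) 0 0 (mat2 0 1 1 0)"

lemma interleave_cases [case_names interleave]:
  obtains P Q where "X = interleave P Q"
proof
  let ?C = "left_half X" and ?D = "right_half X"
  show "X = interleave (mat2 (?C $ 1 $ 1) (?D $ 1 $ 1) (?C $ 2 $ 1) (?D $ 2 $ 1))
    (mat2 (?C $ 1 $ 2) (?D $ 1 $ 2) (?C $ 2 $ 2) (?D $ 2 $ 2))"
    by (simp add: interleave_def mat2_collapse)
qed

lemma interleave_mult_sp_times:
  "interleave P Q ** sp_times M N = interleave (P ** M) (Q ** N)"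
  by (cases P rule: mat2_cases; cases Q rule: mat2_cases; cases M rule: mat2_cases;
    cases N rule: mat2_cases)
   (simp add: interleave_def sp_times_def beside_mult_block_matrix diag2_eq_mat2)

lemma interleave_mult_swap_planes: "interleave P Q ** swap_planes = interleave Q P"
  by (cases P rule: mat2_cases; cases Q rule: mat2_cases)
   (simp add: interleave_def swap_planes_def beside_mult_block_matrix)

lemma mult_interleave:
  fixes A :: "'a::semiring_1^2^2"
  shows "A ** interleave P Q = interleave (A ** P) (A ** Q)"
  by (cases P rule: mat2_cases; cases Q rule: mat2_cases; cases A rule: mat2_cases)
   (simp add: interleave_def mult_beside)

lemma sp_times_mult: "sp_times M N ** sp_times M' N' = sp_times (M ** M') (N ** N')"
  by (cases M rule: mat2_cases; cases N rule: mat2_cases; cases M' rule: mat2_cases;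
    cases N' rule: mat2_cases)
   (simp add: sp_times_def block_matrix_mult diag2_eq_mat2)

lemma sp_times_1: "sp_times (mat 1) (mat 1) = mat 1"
  by (simp add: sp_times_def mat_1_block mat_eq_mat2 diag2_eq_mat2 flip: zero_eq_mat2)

lemma sp_times_in_Sp2_R: "sp_times M N \<in> Sp2_R \<longleftrightarrow> det M = 1 \<and> det N = 1"
  by (cases M rule: mat2_cases; cases N rule: mat2_cases)
   (auto simp: sp_times_def block_matrix_in_Sp2_R_iff diag2_eq_mat2 mat_eq_mat2
     diff_conv_add_uminus simp del: add_uminus_conv_diff)

lemma sp_times_in_Sp2_Z: "M \<in> SL2_Z \<Longrightarrow> N \<in> SL2_Z \<Longrightarrow> sp_times M N \<in> Sp2_Z"
  unfolding Sp2_Z_def SL2_Z_def int_mats_det_def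
  by (cases M rule: mat2_cases; cases N rule: mat2_cases)
   (auto simp: sp_times_in_Sp2_R, auto simp: sp_times_def diag2_eq_mat2)

lemma swap_planes_in_Sp2_Z: "swap_planes \<in> Sp2_Z"
  by (simp add: Sp2_Z_def swap_planes_def block_matrix_in_Sp2_R_iff mat_eq_mat2 zero_eq_mat2)

lemma sp_times_swap: "sp_times M N ** swap_planes = swap_planes ** sp_times N M"
  by (simp add: sp_times_def swap_planes_def block_matrix_mult diag2_eq_mat2)

lemma swap_planes_sq: "swap_planes ** swap_planes = mat 1"
  by (simp add: swap_planes_def block_matrix_mult mat_1_block mat_eq_mat2)

text \<open>The symplectic product of the two rows is the sum of their area forms in the two planes,
  that is \<open>det P + det Q\<close>, and the rows of a lower half are isotropic.\<close>

lemma interleave_lagrangian: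
  assumes "g \<in> Sp2_R" and "lower_half g = interleave P Q"
  shows "det P + det Q = 0"
proof -
  obtain A B C D where g: "g = block_matrix A B C D"
    by (rule block_matrix_cases)
  obtain p1 p2 p3 p4 where P: "P = mat2 p1 p2 p3 p4" by (rule mat2_cases)
  obtain q1 q2 q3 q4 where Q: "Q = mat2 q1 q2 q3 q4" by (rule mat2_cases)
  have "C ** transpose D = D ** transpose C"
    using assms(1) g block_matrix_in_Sp2_R_iff by blast
  moreover have "C = mat2 p1 q1 p3 q3" "D = mat2 p2 q2 p4 q4"
    using assms(2) by (simp_all add: g P Q interleave_def)
  ultimately have "mat2 p1 q1 p3 q3 ** transpose (mat2 p2 q2 p4 q4) =
    mat2 p2 q2 p4 q4 ** transpose (mat2 p1 q1 p3 q3)"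
    by simp
  then have "p1 * p4 + q1 * q4 = p2 * p3 + q2 * q3"
    unfolding mat2_transpose mat2_mult mat2_eq_iff by linarith
  then show ?thesis
    by (simp add: P Q)
qed

section \<open>The automorphy factor\<close>

abbreviation cmat :: "real^'n^'m \<Rightarrow> complex^'n^'m"
  where "cmat \<equiv> map_matrix complex_of_real"

text \<open>Defined for any two by four matrix, so that a plane can be evaluated in a basis that is
  not the lower half of a given group element; a change of basis costs its determinant.\<close>

definition lag_det :: "complex^2^2 \<Rightarrow> real^(2 + 2)^2 \<Rightarrow> complex"
  where "lag_det Z P = det (cmat (left_half P) ** Z + cmat (right_half P))"

lemma map_matrix_nth [simp]: "map_matrix f A $ i $ j = f (A $ i $ j)"
  by (simp add: map_matrix_def)

lemma cmat_mult: "cmat (A ** B) = cmat A ** cmat B"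
  by (simp add: matrix_matrix_mult_def vec_eq_iff)

lemma cmat_simps [simp]:
  "cmat (A + B) = cmat A + cmat B" "cmat (A - B) = cmat A - cmat B"
  "cmat 0 = 0" "cmat (mat 1) = mat 1" "cmat (transpose A) = transpose (cmat A)"
  "cmat (- A) = - cmat A"
  by (simp_all add: vec_eq_iff mat_def transpose_def)

lemma det_cmat: "det (cmat (A :: real^2^2)) = of_real (det A)"
  by (simp add: det_2)

lemma aut_factor_eq: "aut_factor g Z = lag_det Z (lower_half g)"
  by (simp add: aut_factor_def sp_denom_def lag_det_def lower_half_def)

lemma lag_det_mult: "lag_det Z (A ** P) = of_real (det A) * lag_det Z P"
proof -
  have "lag_det Z (A ** beside C D) = of_real (det A) * lag_det Z (beside C D)" for C D
    by (simp add: lag_det_def mult_beside cmat_mult det_cmat det_mul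
        flip: matrix_mul_assoc matrix_distribs(4))
  then show ?thesis
    by (metis beside_collapse)
qed

lemma map_matrix_cnj_mult: "map_matrix cnj (A ** B) = map_matrix cnj A ** map_matrix cnj B"
  by (simp add: matrix_matrix_mult_def vec_eq_iff)

text \<open>With \<open>X\<close> equal to \<open>Z\<close> or its adjoint this gives the symmetry and the
  imaginary part of \<open>g(Z)\<close>.\<close>

lemma symplectic_pairing:
  assumes "block_matrix A B C D \<in> Sp2_R"
  shows "(X ** transpose (cmat C) + transpose (cmat D)) ** (cmat A ** Z + cmat B)
    - (X ** transpose (cmat A) + transpose (cmat B)) ** (cmat C ** Z + cmat D) = Z - X"
proof -
  have "block_matrix (transpose A) (transpose C) (transpose B) (transpose D) \<in> Sp2_R"
    using assms unfolding block_matrix_transpose[symmetric]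
    by (simp add: Sp2_R_iff_transpose[of "transpose _"]) (simp add: Sp2_R_def)
  then have rel: "transpose A ** C = transpose C ** A" "transpose B ** D = transpose D ** B"
    "transpose A ** D - transpose C ** B = mat 1"
    by (simp_all add: block_matrix_in_Sp2_R_iff)
  have rel4: "transpose D ** A - transpose B ** C = mat 1"
  proof -
    have "transpose (transpose A ** D - transpose C ** B) = transpose D ** A - transpose B ** C"
      using matrix_transpose_mul[of "transpose A" D] matrix_transpose_mul[of "transpose C" B]
      by (simp add: vec_eq_iff transpose_def)
    then show ?thesis
      by (metis rel(3) transpose_mat)
  qed
  have r: "transpose (cmat C) ** cmat A - transpose (cmat A) ** cmat C = 0"
    "transpose (cmat D) ** cmat B - transpose (cmat B) ** cmat D = 0"
    "transpose (cmat C) ** cmat B - transpose (cmat A) ** cmat D = - mat 1"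
    "transpose (cmat D) ** cmat A - transpose (cmat B) ** cmat C = mat 1"
  proof -
    have "transpose C ** B - transpose A ** D = - mat 1"
      using rel(3) by (metis minus_diff_eq)
    then have "cmat (transpose C ** A - transpose A ** C) = 0"
      "cmat (transpose D ** B - transpose B ** D) = 0"
      "cmat (transpose C ** B - transpose A ** D) = - mat 1"
      "cmat (transpose D ** A - transpose B ** C) = mat 1"
      using rel rel4 by (simp_all del: cmat_simps(2))
    then show
      "transpose (cmat C) ** cmat A - transpose (cmat A) ** cmat C = 0"
      "transpose (cmat D) ** cmat B - transpose (cmat B) ** cmat D = 0"
      "transpose (cmat C) ** cmat B - transpose (cmat A) ** cmat D = - mat 1"
      "transpose (cmat D) ** cmat A - transpose (cmat B) ** cmat C = mat 1"
      by (simp_all add: cmat_mult)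
  qed
  have "?thesis \<longleftrightarrow> X ** (transpose (cmat C) ** cmat A - transpose (cmat A) ** cmat C) ** Z
    + X ** (transpose (cmat C) ** cmat B - transpose (cmat A) ** cmat D)
    + (transpose (cmat D) ** cmat A - transpose (cmat B) ** cmat C) ** Z
    + (transpose (cmat D) ** cmat B - transpose (cmat B) ** cmat D) = Z - X"
    by (simp add: matrix_distribs matrix_mul_assoc algebra_simps)
  then show ?thesis
    by (simp add: r matrix_mult_uminus)
qed

lemma positive_definite_quadratic_form:
  assumes "positive_definite (mat2 a b b d)" and "x \<noteq> 0 \<or> y \<noteq> 0"
  shows "a * x\<^sup>2 + 2 * b * x * y + d * y\<^sup>2 > 0"
proof -
  let ?v = "vector [x, y] :: real^2"
  have "?v \<noteq> 0"
    using assms(2) by (auto simp: vec_eq_iff forall_2)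
  then have "?v \<bullet> (mat2 a b b d *v ?v) > 0"
    using assms(1) unfolding positive_definite_def by blast
  then show ?thesis
    by (simp add: inner_vec_def matrix_vector_mult_def sum_2 algebra_simps power2_eq_square)
qed

text \<open>The real part of the Hermitian form is the sum of the real quadratic form at the real
  parts and at the imaginary parts of the vector, and both values are nonnegative.\<close>

lemma positive_definite_complex_form:
  fixes v w :: complex
  assumes "positive_definite (mat2 a b b d)"
    and "cnj v * (of_real a * v + of_real b * w) + cnj w * (of_real b * v + of_real d * w) = 0"
  shows "v = 0 \<and> w = 0"
proof (rule ccontr)
  assume "\<not> (v = 0 \<and> w = 0)"
  let ?q = "\<lambda>x y. a * x\<^sup>2 + 2 * b * x * y + d * y\<^sup>2"
  have "?q (Re v) (Re w) + ?q (Im v) (Im w) = 0"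
    using arg_cong[OF assms(2), of Re] by (simp add: algebra_simps power2_eq_square)
  moreover have "?q x y \<ge> 0" for x y
    using positive_definite_quadratic_form[OF assms(1), of x y]
    by (cases "x = 0 \<and> y = 0") (auto simp: less_imp_le)
  ultimately have "?q (Re v) (Re w) = 0" "?q (Im v) (Im w) = 0"
    by (smt (verit))+
  then have "Re v = 0 \<and> Re w = 0" "Im v = 0 \<and> Im w = 0"
    using positive_definite_quadratic_form[OF assms(1)] by (metis less_irrefl)+
  then show False
    using \<open>\<not> (v = 0 \<and> w = 0)\<close> by (simp add: complex_eq_iff)
qed

lemma siegel_H2_cases:
  assumes "Z \<in> siegel_H2"
  obtains x y w where "Z = mat2 x y y w" "positive_definite (mat2 (Im x) (Im y) (Im y) (Im w))"
proof -
  obtain x y y' w where Z: "Z = mat2 x y y' w"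
    by (rule mat2_cases)
  have "transpose Z = Z"
    using assms by (simp add: siegel_H2_def)
  then have "y' = y"
    unfolding Z mat2_transpose mat2_eq_iff by blast
  moreover have "map_matrix Im (mat2 x y y w) = mat2 (Im x) (Im y) (Im y) (Im w)"
    by (simp add: vec_eq_iff forall_2)
  ultimately show thesis
    using assms that Z by (simp add: siegel_H2_def)
qed

lemma siegel_H2_symmetric: "Z \<in> siegel_H2 \<Longrightarrow> transpose Z = Z"
  by (simp add: siegel_H2_def)

lemma transpose_add: "transpose (A + B) = transpose A + transpose B"
  by (simp add: transpose_def vec_eq_iff)

lemma map_matrix_cnj_simps:
  "map_matrix cnj (A + B) = map_matrix cnj A + map_matrix cnj B"
  "map_matrix cnj (transpose A) = transpose (map_matrix cnj A)"
  "map_matrix cnj (cmat M) = cmat M"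
  by (simp_all add: transpose_def vec_eq_iff)

text \<open>A vector v killed by the denominator \<open>N\<close> makes the pairing of numerator and
  denominator vanish, so the Hermitian form of \<open>2 * \<i>\<close> times the imaginary part of
  \<open>Z\<close> vanishes at v, which forces v = 0. The matrices \<open>V\<close> carry two such
  vectors in their columns.\<close>

lemma aut_factor_nonzero:
  assumes "g \<in> Sp2_R" "Z \<in> siegel_H2"
  shows "aut_factor g Z \<noteq> 0"
proof
  assume zero: "aut_factor g Z = 0"
  obtain A B C D where g: "g = block_matrix A B C D"
    by (rule block_matrix_cases)
  define N where "N = sp_denom g Z"
  define M where "M = cmat A ** Z + cmat B"
  define S where "S = (\<lambda>X :: complex^2^2. map_matrix cnj (transpose X))"
  have S_mult: "S (X ** Y) = S Y ** S X" for X Y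
    by (simp add: S_def matrix_transpose_mul map_matrix_cnj_mult)
  have N: "N = cmat C ** Z + cmat D"
    by (simp add: N_def sp_denom_def g)
  have pair: "S N ** M - S M ** N = Z - S Z"
    using symplectic_pairing[of A B C D "S Z" Z] assms(1)
    unfolding g N M_def
    by (simp add: S_def transpose_add matrix_transpose_mul map_matrix_cnj_mult map_matrix_cnj_simps)
  have form: "S V ** (Z - S Z) ** V = S (N ** V) ** (M ** V) - S (M ** V) ** (N ** V)"
    for V :: "complex^2^2"
    unfolding pair[symmetric] S_mult by (simp add: matrix_distribs matrix_mul_assoc)
  obtain x y w where Z: "Z = mat2 x y y w"
    and pd: "positive_definite (mat2 (Im x) (Im y) (Im y) (Im w))"
    using assms(2) by (rule siegel_H2_cases)
  have V0: "V = 0" if "N ** V = 0" for V :: "complex^2^2"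
  proof -
    obtain p q r t where V: "V = mat2 p q r t" by (rule mat2_cases)
    have SV: "S V = mat2 (cnj p) (cnj r) (cnj q) (cnj t)"
      by (simp add: S_def V vec_eq_iff forall_2)
    have D: "Z - S Z = mat2 (2 * \<i> * of_real (Im x)) (2 * \<i> * of_real (Im y))
      (2 * \<i> * of_real (Im y)) (2 * \<i> * of_real (Im w))"
      by (simp add: S_def Z vec_eq_iff forall_2 complex_diff_cnj)
    have e0: "S V ** (Z - S Z) ** V = 0"
    proof -
      have "S 0 = 0"
        by (simp add: S_def vec_eq_iff transpose_def)
      then show ?thesis
        unfolding form that by simp
    qed
    have e1:
      "(S V ** (Z - S Z) ** V) $ 1 $ 1 =
        2 * \<i> * (cnj p * (Im x * p + Im y * r) + cnj r * (Im y * p + Im w * r))"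
      "(S V ** (Z - S Z) ** V) $ 2 $ 2 =
        2 * \<i> * (cnj q * (Im x * q + Im y * t) + cnj t * (Im y * q + Im w * t))"
      unfolding SV D unfolding V mat2_mult mat2_nth by (simp_all add: algebra_simps)
    have "2 * \<i> * (cnj p * (Im x * p + Im y * r) + cnj r * (Im y * p + Im w * r)) = 0"
      "2 * \<i> * (cnj q * (Im x * q + Im y * t) + cnj t * (Im y * q + Im w * t)) = 0"
      using e1[unfolded e0 zero_index, symmetric] by blast+
    then have "cnj p * (Im x * p + Im y * r) + cnj r * (Im y * p + Im w * r) = 0"
      "cnj q * (Im x * q + Im y * t) + cnj t * (Im y * q + Im w * t) = 0"
      by (simp_all only: mult_eq_0_iff) simp_all
    then have "p = 0 \<and> r = 0" "q = 0 \<and> t = 0"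
      using positive_definite_complex_form[OF pd] by blast+
    then show "V = 0"
      by (simp add: V flip: zero_eq_mat2)
  qed
  obtain a b c d where N': "N = mat2 a b c d" by (rule mat2_cases)
  have "det N = 0"
    using zero by (simp add: aut_factor_def N_def)
  \<comment> \<open>The product of \<open>N\<close> and its adjugate is \<open>det N\<close> times
    the identity, so a singular \<open>N\<close> annihilates its adjugate, which is then zero and
    takes \<open>N\<close> with it.\<close>
  then have "N ** mat2 d (- b) (- c) a = 0"
    by (simp add: N' zero_eq_mat2 mult.commute)
  then have "N = 0"
    using V0 N' by (metis mat2_eq_iff neg_equal_0_iff_equal zero_eq_mat2)
  then have "mat 1 = (0 :: complex^2^2)"
    using V0[of "mat 1"] by simp
  then show False
    by (simp add: mat_eq_mat2 zero_eq_mat2)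
qed

section \<open>The action and its cocycle relation\<close>

lemma matrix_inv_unique_det:
  fixes N :: "complex^2^2"
  assumes "det N \<noteq> 0"
  shows "N ** matrix_inv N = mat 1" "matrix_inv N ** N = mat 1"
  using assms invertible_det_nz[of N] unfolding matrix_inv_def invertible_def
  by (metis (mono_tags, lifting) someI_ex)+

lemma sp_act_denom:
  assumes "aut_factor g Z \<noteq> 0"
  shows "sp_act g Z ** sp_denom g Z = cmat (block_A g) ** Z + cmat (block_B g)"
  using assms matrix_inv_unique_det(2)[of "sp_denom g Z"]
  by (simp add: sp_act_def aut_factor_def flip: matrix_mul_assoc)

lemma sp_act_unique:
  assumes "aut_factor g Z \<noteq> 0"
    and "W ** sp_denom g Z = cmat (block_A g) ** Z + cmat (block_B g)"
  shows "sp_act g Z = W"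
  using assms matrix_inv_unique_det(1)[of "sp_denom g Z"]
  by (simp add: sp_act_def aut_factor_def flip: assms(2) matrix_mul_assoc)

lemma sp_denom_cocycle:
  assumes "aut_factor h Z \<noteq> 0"
  shows "sp_denom (g ** h) Z = sp_denom g (sp_act h Z) ** sp_denom h Z"
proof -
  obtain A B C D where g: "g = block_matrix A B C D" by (rule block_matrix_cases)
  obtain A' B' C' D' where h: "h = block_matrix A' B' C' D'" by (rule block_matrix_cases)
  have "sp_denom g (sp_act h Z) ** sp_denom h Z
    = cmat C ** (sp_act h Z ** sp_denom h Z) + cmat D ** sp_denom h Z"
    by (simp add: sp_denom_def[of "block_matrix A B C D"] g matrix_distribs matrix_mul_assoc)
  also have "\<dots> = sp_denom (g ** h) Z"
    unfolding sp_act_denom[OF assms] unfolding sp_denom_def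
    by (simp add: g h block_matrix_mult cmat_mult matrix_distribs matrix_mul_assoc add_ac)
  finally show ?thesis ..
qed

lemma aut_factor_cocycle:
  assumes "aut_factor h Z \<noteq> 0"
  shows "aut_factor (g ** h) Z = aut_factor g (sp_act h Z) * aut_factor h Z"
  using sp_denom_cocycle[OF assms] by (simp add: aut_factor_def det_mul)

lemma sp_act_mult:
  assumes "aut_factor h Z \<noteq> 0" "aut_factor (g ** h) Z \<noteq> 0"
  shows "sp_act (g ** h) Z = sp_act g (sp_act h Z)"
proof (rule sp_act_unique[OF assms(2)])
  obtain A B C D where g: "g = block_matrix A B C D" by (rule block_matrix_cases)
  obtain A' B' C' D' where h: "h = block_matrix A' B' C' D'" by (rule block_matrix_cases)
  have nz: "aut_factor g (sp_act h Z) \<noteq> 0"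
    using assms aut_factor_cocycle[OF assms(1), of g] by auto
  have "sp_act g (sp_act h Z) ** sp_denom (g ** h) Z
    = cmat A ** (sp_act h Z ** sp_denom h Z) + cmat B ** sp_denom h Z"
    unfolding sp_denom_cocycle[OF assms(1)] matrix_mul_assoc sp_act_denom[OF nz]
    by (simp add: g matrix_distribs)
  also have "\<dots> = cmat (block_A (g ** h)) ** Z + cmat (block_B (g ** h))"
    unfolding sp_act_denom[OF assms(1)] unfolding sp_denom_def
    by (simp add: g h block_matrix_mult cmat_mult matrix_distribs matrix_mul_assoc add_ac)
  finally show "sp_act g (sp_act h Z) ** sp_denom (g ** h) Z
    = cmat (block_A (g ** h)) ** Z + cmat (block_B (g ** h))" .
qed

text \<open>For the image \<open>W\<close> the pairing with the adjoint of \<open>Z\<close> reads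
  \<open>S N ** (W - S W) ** N = Z - S Z\<close>, and determinants give the formula. The pairing
  with \<open>Z\<close> itself shows that \<open>W\<close> is symmetric, so that
  \<open>W - S W\<close> is \<open>2 * \<i>\<close> times its imaginary part.\<close>

lemma im_det_sp_act:
  assumes "g \<in> Sp2_R" "Z \<in> siegel_H2"
  shows "im_det (sp_act g Z) = im_det Z / (cmod (aut_factor g Z))\<^sup>2"
proof -
  obtain A B C D where g: "g = block_matrix A B C D"
    by (rule block_matrix_cases)
  have nz: "aut_factor g Z \<noteq> 0"
    using assms by (rule aut_factor_nonzero)
  define N where "N = sp_denom g Z"
  define M where "M = cmat A ** Z + cmat B"
  define W where "W = sp_act g Z"
  have N: "N = cmat C ** Z + cmat D"
    by (simp add: N_def sp_denom_def g)
  have WN: "W ** N = M"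
    using sp_act_denom[OF nz] by (simp add: W_def N_def M_def g)
  define S where "S = (\<lambda>X :: complex^2^2. map_matrix cnj (transpose X))"
  have S_mult: "S (X ** Y) = S Y ** S X" for X Y
    by (simp add: S_def matrix_transpose_mul map_matrix_cnj_mult)
  have pair1: "S N ** M - S M ** N = Z - S Z"
    using symplectic_pairing[of A B C D "S Z" Z] assms(1)
    unfolding g N M_def
    by (simp add: S_def transpose_add matrix_transpose_mul map_matrix_cnj_mult map_matrix_cnj_simps)
  have "transpose N ** M - transpose M ** N = Z - Z"
    using symplectic_pairing[of A B C D Z Z] assms(1) siegel_H2_symmetric[OF assms(2)]
    unfolding g N M_def
    by (simp add: transpose_add matrix_transpose_mul)
  then have eq: "transpose N ** (W ** N) = transpose N ** (transpose W ** N)"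
    unfolding WN[symmetric] by (simp add: matrix_transpose_mul matrix_mul_assoc)
  have symm: "transpose W = W"
  proof -
    have dN: "det N \<noteq> 0" using nz by (simp add: N_def aut_factor_def)
    obtain N1 where N1: "N ** N1 = mat 1" using det_nonzero_inverse[OF dN] by blast
    obtain N2 where N2: "N2 ** transpose N = mat 1"
      using det_nonzero_inverse[of "transpose N"] dN unfolding det_transpose by blast
    have cancel: "N2 ** (transpose N ** (X ** N)) ** N1 = X" for X
    proof -
      have "N2 ** (transpose N ** (X ** N)) ** N1 = (N2 ** transpose N) ** X ** (N ** N1)"
        by (simp only: matrix_mul_assoc)
      then show ?thesis by (simp add: N1 N2)
    qed
    show ?thesis
      using cancel[of W] unfolding eq cancel .
  qed
  have im: "det (X - S X) = - 4 * of_real (im_det X)" if "transpose X = X" for X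
  proof -
    have D: "X - S X = map_matrix (\<lambda>z. 2 * \<i> * of_real (Im z)) X"
      unfolding S_def that by (simp add: vec_eq_iff complex_diff_cnj)
    show ?thesis
      unfolding D by (simp add: im_det_def det_2 algebra_simps)
  qed
  have "S N ** (W - S W) ** N = Z - S Z"
    unfolding pair1[symmetric] WN[symmetric] S_mult
    by (simp add: matrix_distribs matrix_mul_assoc)
  then have "det (S N) * det (W - S W) * det N = det (Z - S Z)"
    by (metis det_mul)
  moreover have "det (S N) = cnj (det N)"
    by (simp add: S_def det_2 transpose_def mult.commute)
  ultimately have "of_real (im_det W * (cmod (det N))\<^sup>2) = (of_real (im_det Z) :: complex)"
    unfolding im[OF symm] im[OF siegel_H2_symmetric[OF assms(2)]]
    unfolding of_real_mult complex_norm_square by (simp add: mult_ac)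
  then have "im_det W * (cmod (det N))\<^sup>2 = im_det Z"
    using of_real_eq_iff by blast
  then show ?thesis
    using nz by (simp add: W_def N_def aut_factor_def field_simps)
qed

section \<open>Integral normal forms\<close>

abbreviation imat :: "int \<Rightarrow> int \<Rightarrow> int \<Rightarrow> int \<Rightarrow> real^2^2"
  where "imat a b c d \<equiv> mat2 (of_int a) (of_int b) (of_int c) (of_int d)"

lemma integral_cases:
  assumes "integral_matrix M"
  obtains a b c d where "M = imat a b c d"
proof -
  obtain a b c d where M: "M = mat2 a b c d" by (rule mat2_cases)
  with assms obtain a' b' c' d' where "a = of_int a'" "b = of_int b'" "c = of_int c'" "d = of_int d'"
    by (auto elim!: Ints_cases)
  then show thesis using that M by blast
qed

lemma imat_in_SL2_Z: "imat a b c d \<in> SL2_Z \<longleftrightarrow> a * d - b * c = 1"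
proof -
  have "(of_int a * of_int d - of_int b * of_int c = (1::real)) \<longleftrightarrow> a * d - b * c = 1"
    by (metis of_int_eq_1_iff of_int_diff of_int_mult)
  then show ?thesis
    by (simp add: SL2_Z_def int_mats_det_def)
qed

lemma SL2_Z_det: "\<gamma> \<in> SL2_Z \<Longrightarrow> det \<gamma> = 1"
  by (simp add: SL2_Z_def int_mats_det_def)

lemma SL2_Z_integral: "\<gamma> \<in> SL2_Z \<Longrightarrow> integral_matrix \<gamma>"
  by (simp add: SL2_Z_def int_mats_det_def)

lemma SL2_Z_mult: "\<gamma> \<in> SL2_Z \<Longrightarrow> \<delta> \<in> SL2_Z \<Longrightarrow> \<gamma> ** \<delta> \<in> SL2_Z"
  by (simp add: SL2_Z_def int_mats_det_def integral_matrix_mult det_mul)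

lemma mat_1_in_SL2_Z: "mat 1 \<in> SL2_Z"
  by (simp add: SL2_Z_def int_mats_det_def integral_matrix_mat)

lemma SL2_Z_has_inverse:
  assumes "\<gamma> \<in> SL2_Z"
  obtains \<delta> where "\<delta> \<in> SL2_Z" "\<gamma> ** \<delta> = mat 1" "\<delta> ** \<gamma> = mat 1"
proof -
  obtain a b c d where g: "\<gamma> = mat2 a b c d" by (rule mat2_cases)
  have "mat2 d (- b) (- c) a \<in> SL2_Z" "\<gamma> ** mat2 d (- b) (- c) a = mat 1"
    using assms by (auto simp: g SL2_Z_def int_mats_det_def mat_eq_mat2 algebra_simps)
  then show thesis
    using that matrix_left_right_inverse by blast
qed

text \<open>Bezout coefficients form the first column of a unimodular matrix; the second column is
  \<open>(- b', a')\<close>, with \<open>a'\<close> and \<open>b'\<close> the quotients by the gcd,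
  and it annihilates the row \<open>(a, b)\<close>.\<close>

lemma row_reduction:
  fixes a b :: int
  obtains p q r t where "p * t - q * r = 1" "a * p + b * r = gcd a b" "a * q + b * t = 0"
proof (cases "a = 0 \<and> b = 0")
  case True
  then show thesis using that[of 1 1 0 0] by simp
next
  case False
  define g where "g = gcd a b"
  have "g \<noteq> 0" using False by (simp add: g_def)
  obtain u v where uv: "u * a + v * b = g"
    unfolding g_def using bezout_int by blast
  obtain a' b' where ab: "a = g * a'" "b = g * b'"
    unfolding g_def by (meson dvdE gcd_dvd1 gcd_dvd2)
  have "g * (u * a' + v * b') = g * 1"
    using uv unfolding ab by (simp add: algebra_simps)
  then have "u * a' - (- b') * v = 1"
    using \<open>g \<noteq> 0\<close> unfolding mult_cancel_left by (simp add: mult.commute)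
  moreover have "a * u + b * v = gcd a b"
    using uv by (simp add: g_def mult.commute)
  moreover have "a * (- b') + b * a' = 0"
    by (simp add: ab)
  ultimately show thesis
    by (rule that)
qed

lemma integral_lower_triangular:
  obtains \<delta> c' d' where "\<delta> \<in> SL2_Z" "imat a b c d ** \<delta> = imat (gcd a b) 0 c' d'"
proof -
  obtain p q r t where *: "p * t - q * r = 1" "a * p + b * r = gcd a b" "a * q + b * t = 0"
    by (rule row_reduction)
  have "imat a b c d ** imat p q r t =
    imat (a * p + b * r) (a * q + b * t) (c * p + d * r) (c * q + d * t)"
    by simp
  then show thesis
    using that[of "imat p q r t"] * by (metis imat_in_SL2_Z)
qed

lemma integral_upper_triangular:
  obtains \<gamma> b' d' where "\<gamma> \<in> SL2_Z" "\<gamma> ** imat a b c d = imat (gcd a c) b' 0 d'"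
proof -
  obtain p q r t where *: "p * t - q * r = 1" "a * p + c * r = gcd a c" "a * q + c * t = 0"
    by (rule row_reduction)
  have "imat p r q t ** imat a b c d =
    imat (a * p + c * r) (p * b + r * d) (a * q + c * t) (q * b + t * d)"
    by (simp add: mult.commute)
  then show thesis
    using that[of "imat p r q t"] * by (metis imat_in_SL2_Z mult.commute)
qed

text \<open>Euclid's algorithm on the pivot: if \<open>a\<close> divides \<open>c\<close>, one row
  operation finishes; otherwise clearing the first column and then the first row replaces
  \<open>a\<close> by a divisor of \<open>gcd a c\<close>, which is smaller.\<close>

lemma diagonalize_triangular:
  fixes a c d :: int
  assumes "a > 0"
  shows "\<exists>\<gamma>\<in>SL2_Z. \<exists>\<delta>\<in>SL2_Z. \<exists>x y. \<gamma> ** imat a 0 c d ** \<delta> = mat2 x 0 0 y"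
  using assms
proof (induction "nat a" arbitrary: a c d rule: less_induct)
  case less
  show ?case
  proof (cases "a dvd c")
    case True
    then obtain m where m: "c = a * m" ..
    have "imat 1 0 (- m) 1 ** imat a 0 c d ** mat 1 = mat2 a 0 0 d"
      by (simp add: m)
    moreover have "imat 1 0 (- m) 1 \<in> SL2_Z"
      by (subst imat_in_SL2_Z) simp
    ultimately show ?thesis
      using mat_1_in_SL2_Z by blast
  next
    case False
    obtain \<gamma> b' d' where 1: "\<gamma> \<in> SL2_Z" "\<gamma> ** imat a 0 c d = imat (gcd a c) b' 0 d'"
      by (rule integral_upper_triangular)
    obtain \<delta> c'' d'' where 2: "\<delta> \<in> SL2_Z"
      "imat (gcd a c) b' 0 d' ** \<delta> = imat (gcd (gcd a c) b') 0 c'' d''"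
      by (rule integral_lower_triangular)
    have "gcd a c < a"
      using False less.prems by (metis gcd_dvd2 gcd_le1_int order_le_less)
    moreover have "gcd (gcd a c) b' \<le> gcd a c" "gcd (gcd a c) b' > 0"
      using less.prems by (auto simp: gcd_le1_int)
    ultimately obtain \<gamma>' \<delta>' x y where 3: "\<gamma>' \<in> SL2_Z" "\<delta>' \<in> SL2_Z"
      "\<gamma>' ** imat (gcd (gcd a c) b') 0 c'' d'' ** \<delta>' = mat2 x 0 0 y"
      using less.hyps[of "gcd (gcd a c) b'" c'' d''] by auto
    have "(\<gamma>' ** \<gamma>) ** imat a 0 c d ** (\<delta> ** \<delta>') = \<gamma>' ** ((\<gamma> ** imat a 0 c d) ** \<delta>) ** \<delta>'"
      by (simp only: matrix_mul_assoc)
    also have "\<dots> = mat2 x 0 0 y"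
      unfolding 1 2 3 ..
    finally show ?thesis
      using 1 2 3 SL2_Z_mult by blast
  qed
qed

lemma integral_diagonalization:
  assumes "integral_matrix M" "det M \<noteq> 0"
  obtains \<gamma> \<delta> x y where "\<gamma> \<in> SL2_Z" "\<delta> \<in> SL2_Z" "\<gamma> ** M ** \<delta> = mat2 x 0 0 y"
proof -
  obtain a b c d where M: "M = imat a b c d"
    using assms(1) by (rule integral_cases)
  have "gcd a b > 0"
    using assms(2) by (auto simp: M)
  obtain \<delta> c' d' where 1: "\<delta> \<in> SL2_Z" "imat a b c d ** \<delta> = imat (gcd a b) 0 c' d'"
    by (rule integral_lower_triangular)
  obtain \<gamma> \<delta>' x y where 2: "\<gamma> \<in> SL2_Z" "\<delta>' \<in> SL2_Z"
    "\<gamma> ** imat (gcd a b) 0 c' d' ** \<delta>' = mat2 x 0 0 y"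
    using diagonalize_triangular[OF \<open>gcd a b > 0\<close>] by metis
  have "\<gamma> ** M ** (\<delta> ** \<delta>') = \<gamma> ** (imat a b c d ** \<delta>) ** \<delta>'"
    by (simp only: M matrix_mul_assoc)
  then have "\<gamma> ** M ** (\<delta> ** \<delta>') = mat2 x 0 0 y"
    unfolding 1 2 .
  then show thesis
    using that 1 2 SL2_Z_mult by blast
qed

lemma integral_singular:
  assumes "integral_matrix M" "det M = 0"
  obtains \<delta> u v where "\<delta> \<in> SL2_Z" "M ** \<delta> = mat2 0 u 0 v"
proof -
  have w: "imat 0 (-1) 1 0 \<in> SL2_Z"
    by (subst imat_in_SL2_Z) simp
  have "\<exists>\<delta>\<in>SL2_Z. \<exists>u v. M ** \<delta> = mat2 u 0 v 0"
  proof -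
    obtain a b c d where M: "M = imat a b c d"
      using assms(1) by (rule integral_cases)
    show ?thesis
    proof (cases "a = 0 \<and> b = 0")
      case True
      obtain p q r t where "p * t - q * r = 1" "c * p + d * r = gcd c d" "c * q + d * t = 0"
        by (rule row_reduction)
      then have "imat p q r t \<in> SL2_Z" "M ** imat p q r t = mat2 0 0 (gcd c d) 0"
        using True by (auto simp: M imat_in_SL2_Z simp flip: of_int_mult of_int_add)
      then show ?thesis by blast
    next
      case False
      obtain \<delta> c' d' where 1: "\<delta> \<in> SL2_Z" "M ** \<delta> = imat (gcd a b) 0 c' d'"
        unfolding M by (rule integral_lower_triangular)
      have "det (M ** \<delta>) = 0"
        using assms by (simp add: det_mul)
      then have "d' = 0"
        using False by (simp add: 1)
      then show ?thesis
        using 1 by (metis of_int_0)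
    qed
  qed
  then obtain \<delta> u v where \<delta>: "\<delta> \<in> SL2_Z" "M ** \<delta> = mat2 u 0 v 0"
    by blast
  \<comment> \<open>The quarter turn moves the zero column to the front, where the normal form for
    pairs of lines has it.\<close>
  have "M ** (\<delta> ** imat 0 (-1) 1 0) = mat2 0 (-u) 0 (-v)"
    by (simp add: matrix_mul_assoc \<delta>)
  then show thesis
    using that w \<delta>(1) SL2_Z_mult by blast
qed

text \<open>Rationality up to a real scalar: \<open>normalize_det\<close> divides by a square root,
  so integrality survives only in this form. The factor may differ from matrix to matrix, in
  particular between the two planes.\<close>

definition proportional_integral :: "real^'n^'m \<Rightarrow> bool"
  where "proportional_integral M \<longleftrightarrow> (\<exists>r. r \<noteq> 0 \<and> integral_matrix (r *\<^sub>R M))"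

lemma proportional_integral_mult:
  assumes "proportional_integral M" "proportional_integral N"
  shows "proportional_integral (M ** N)"
proof -
  obtain r r' where "r \<noteq> 0" "r' \<noteq> 0" "integral_matrix (r *\<^sub>R M)" "integral_matrix (r' *\<^sub>R N)"
    using assms by (auto simp: proportional_integral_def)
  moreover have "(r *\<^sub>R M) ** (r' *\<^sub>R N) = (r * r') *\<^sub>R (M ** N)"
    by (simp add: matrix_matrix_mult_def vec_eq_iff sum_distrib_left mult_ac)
  ultimately show ?thesis
    unfolding proportional_integral_def by (metis integral_matrix_mult mult_eq_0_iff)
qed

lemma integral_imp_proportional: "integral_matrix M \<Longrightarrow> proportional_integral M"
  unfolding proportional_integral_def by (metis scaleR_one zero_neq_one)

lemma proportional_integral_scaleR:
  assumes "integral_matrix M" "r \<noteq> 0"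
  shows "proportional_integral (r *\<^sub>R M)"
  unfolding proportional_integral_def using assms by (intro exI[of _ "inverse r"]) simp

lemma proportional_diagonalization:
  assumes "proportional_integral M" "det M \<noteq> 0"
  obtains \<gamma> \<delta> x y where "\<gamma> \<in> SL2_Z" "\<delta> \<in> SL2_Z" "\<gamma> ** M ** \<delta> = mat2 x 0 0 y"
proof -
  obtain r where r: "r \<noteq> 0" "integral_matrix (r *\<^sub>R M)"
    using assms by (auto simp: proportional_integral_def)
  have "det (r *\<^sub>R M) \<noteq> 0"
    using assms r by (simp add: det_2)
  then obtain \<gamma> \<delta> x y where *: "\<gamma> \<in> SL2_Z" "\<delta> \<in> SL2_Z" "\<gamma> ** (r *\<^sub>R M) ** \<delta> = mat2 x 0 0 y"
    using integral_diagonalization r(2) by blast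
  have "\<gamma> ** (r *\<^sub>R M) ** \<delta> = r *\<^sub>R (\<gamma> ** M ** \<delta>)"
    by (simp add: matrix_matrix_mult_def vec_eq_iff sum_distrib_left mult_ac)
  then have "\<gamma> ** M ** \<delta> = inverse r *\<^sub>R mat2 x 0 0 y"
    using r * by simp
  then show thesis
    using that * by simp
qed

lemma proportional_singular:
  assumes "proportional_integral M" "det M = 0"
  obtains \<delta> u v where "\<delta> \<in> SL2_Z" "M = mat2 0 u 0 v ** \<delta>"
proof -
  obtain r where r: "r \<noteq> 0" "integral_matrix (r *\<^sub>R M)"
    using assms by (auto simp: proportional_integral_def)
  have "det (r *\<^sub>R M) = r\<^sup>2 * det M"
    by (simp add: det_2 algebra_simps power2_eq_square)
  then have "det (r *\<^sub>R M) = 0"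
    using assms by simp
  then obtain \<delta> u v where *: "\<delta> \<in> SL2_Z" "(r *\<^sub>R M) ** \<delta> = mat2 0 u 0 v"
    using integral_singular r(2) by blast
  obtain \<delta>' where \<delta>': "\<delta>' \<in> SL2_Z" "\<delta> ** \<delta>' = mat 1"
    using * SL2_Z_has_inverse by blast
  have "(r *\<^sub>R M) ** \<delta> = r *\<^sub>R (M ** \<delta>)"
    by (simp add: matrix_matrix_mult_def vec_eq_iff sum_distrib_left mult_ac)
  then have "mat2 0 u 0 v = r *\<^sub>R (M ** \<delta>)"
    by (simp only: *(2))
  then have "M ** \<delta> = inverse r *\<^sub>R mat2 0 u 0 v"
    using r(1) by (simp del: mat2_scaleR)
  then have M\<delta>: "M ** \<delta> = mat2 0 (inverse r * u) 0 (inverse r * v)"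
    by simp
  have "M = M ** \<delta> ** \<delta>'"
    using \<delta>' by (simp flip: matrix_mul_assoc)
  then show thesis
    unfolding M\<delta> using that \<delta>'(1) by blast
qed

text \<open>A Lagrangian that is rational for a rescaled lattice is either a sum of two lines or the
  graph of an anti-isometry between the two planes; modulo \<open>SL2_Z\<close> on each plane, the
  line pairs form one orbit and the graphs are those of the diagonal matrices.\<close>

lemma lagrangian_normal_form:
  assumes P: "proportional_integral P" and Q: "proportional_integral Q"
    and lag: "det P + det Q = 0"
    and nondeg: "\<And>A :: real^2^2. A ** interleave P Q = 0 \<Longrightarrow> A = 0"
  obtains A \<gamma> \<delta> where "det A \<noteq> 0" "\<gamma> \<in> SL2_Z" "\<delta> \<in> SL2_Z"
      "interleave P Q = A ** interleave (mat2 0 1 0 0) (mat2 0 0 0 1) ** sp_times \<gamma> \<delta>"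
  | A \<gamma> \<delta> x y where "det A \<noteq> 0" "\<gamma> \<in> SL2_Z" "\<delta> \<in> SL2_Z" "x * y = -1"
      "interleave P Q = A ** interleave (mat 1) (mat2 x 0 0 y) ** sp_times \<gamma> \<delta>"
proof (cases "det P = 0")
  case True
  then have "det Q = 0" using lag by simp
  obtain \<gamma> u v where 1: "\<gamma> \<in> SL2_Z" "P = mat2 0 u 0 v ** \<gamma>"
    using proportional_singular[OF P True] .
  obtain \<delta> u' v' where 2: "\<delta> \<in> SL2_Z" "Q = mat2 0 u' 0 v' ** \<delta>"
    using proportional_singular[OF Q \<open>det Q = 0\<close>] .
  \<comment> \<open>Modulo \<open>SL2_Z\<close> each line is spanned by the second coordinate vector
    of its plane; the columns of \<open>?A\<close> hold the coefficients along these two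
    vectors.\<close>
  let ?A = "mat2 u u' v v'" and ?P0 = "interleave (mat2 0 1 0 0) (mat2 0 0 0 1) :: real^(2+2)^2"
  have eq: "interleave P Q = ?A ** ?P0 ** sp_times \<gamma> \<delta>"
    by (simp add: 1 2 mult_interleave interleave_mult_sp_times)
  have "det ?A \<noteq> 0"
  proof
    assume "det ?A = 0"
    \<comment> \<open>The adjugate of a singular \<open>?A\<close> kills it, hence kills the basis.
      Nondegeneracy makes the adjugate zero, so \<open>?A\<close> is zero, and then the identity
      matrix would be zero as well.\<close>
    then have "mat2 v' (- u') (- v) u ** ?A = 0"
      by (simp add: zero_eq_mat2 algebra_simps)
    then have "mat2 v' (- u') (- v) u ** interleave P Q = 0"
      unfolding eq by (simp add: matrix_mul_assoc)
    from nondeg[OF this] have "?A = 0"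
      by (simp add: zero_eq_mat2)
    then have "mat 1 ** interleave P Q = 0"
      unfolding eq by (simp add: matrix_mul_assoc)
    from nondeg[OF this] show False
      by (simp add: zero_eq_mat2 mat_eq_mat2)
  qed
  then show thesis
    using that(1) 1 2 eq by blast
next
  case False
  obtain a b c d where Pm: "P = mat2 a b c d" by (rule mat2_cases)
  let ?adj = "mat2 d (- b) (- c) a"
  define P' where "P' = inverse (det P) *\<^sub>R ?adj"
  have PP': "P ** P' = mat 1"
  proof -
    have "P ** ?adj = mat2 (det P) 0 0 (det P)"
      by (simp add: Pm mult.commute)
    then have "P ** P' = inverse (det P) *\<^sub>R mat2 (det P) 0 0 (det P)"
      unfolding P'_def matrix_scalar_ac scalar_matrix_assoc[symmetric] by (simp only:)
    then show ?thesis
      using False by (simp add: mat_eq_mat2)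
  qed
  obtain r where r: "r \<noteq> 0" "integral_matrix (r *\<^sub>R P)"
    using P by (auto simp: proportional_integral_def)
  have "(r * det P) *\<^sub>R P' = r *\<^sub>R ?adj"
    using False by (simp add: P'_def del: mat2_scaleR)
  moreover have "integral_matrix (r *\<^sub>R ?adj)"
    using r by (simp add: Pm minus_in_Ints_iff)
  ultimately have "proportional_integral P'"
    unfolding proportional_integral_def using r(1) False by (metis mult_eq_0_iff)
  \<comment> \<open>In the basis normalised to the identity in the first plane,
    \<open>P' ** Q\<close> is the map whose graph the Lagrangian is; \<open>lag\<close> gives it
    determinant -1.\<close>
  then have "proportional_integral (P' ** Q)"
    using Q by (rule proportional_integral_mult)
  moreover have "det P * det (P' ** Q) = - det P"
    using PP' lag by (metis add.commute add_eq_0_iff det_mul matrix_mul_assoc matrix_mul_lid)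
  then have det: "det (P' ** Q) = -1"
    using False by (metis mult_cancel_left mult_minus1_right)
  ultimately obtain \<gamma> \<delta> x y where 1: "\<gamma> \<in> SL2_Z" "\<delta> \<in> SL2_Z"
    "\<gamma> ** (P' ** Q) ** \<delta> = mat2 x 0 0 y"
    using proportional_diagonalization by (metis neg_equal_0_iff_equal zero_neq_one)
  obtain \<gamma>' where g: "\<gamma> ** \<gamma>' = mat 1" "\<gamma>' ** \<gamma> = mat 1"
    using SL2_Z_has_inverse[OF 1(1)] by blast
  obtain \<delta>' where d: "\<delta>' \<in> SL2_Z" "\<delta> ** \<delta>' = mat 1"
    using SL2_Z_has_inverse[OF 1(2)] by blast
  have "det \<gamma> * det (P' ** Q) * det \<delta> = det (mat2 x 0 0 y)"
    unfolding 1(3)[symmetric] by (simp add: det_mul)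
  then have "x * y = -1"
    using 1 unfolding det by (simp add: SL2_Z_det)
  have PA: "P = P ** \<gamma>' ** \<gamma>"
    using g by (simp flip: matrix_mul_assoc)
  have "P ** \<gamma>' ** (\<gamma> ** (P' ** Q) ** \<delta>) ** \<delta>' = P ** (\<gamma>' ** \<gamma>) ** P' ** Q ** (\<delta> ** \<delta>')"
    by (simp only: matrix_mul_assoc)
  then have QA: "P ** \<gamma>' ** mat2 x 0 0 y ** \<delta>' = Q"
    unfolding 1 using g d PP' by simp
  have eq: "interleave P Q = (P ** \<gamma>') ** interleave (mat 1) (mat2 x 0 0 y) ** sp_times \<gamma> \<delta>'"
    using PA QA by (simp add: mult_interleave interleave_mult_sp_times)
  have "det P = det (P ** \<gamma>') * det \<gamma>"
    using PA by (metis det_mul)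
  then have "det (P ** \<gamma>') \<noteq> 0"
    using False by auto
  then show thesis
    using that(2) 1 d eq \<open>x * y = -1\<close> by blast
qed

text \<open>Moving the swap past \<open>sp_times \<gamma> \<delta>\<close> exchanges \<gamma> and
  \<delta>, so the swap normalises the product group. The property thus passes from the
  representative \<open>P0\<close> to its orbit, with the pair
  \<open>\<gamma>' ** w ** \<delta>\<close> and \<open>\<delta>' ** w' ** \<gamma>\<close> and a
  conjugate of \<open>B\<close>.\<close>

lemma swap_planes_conjugation:
  assumes P: "P = A ** P0 ** sp_times \<gamma> \<delta>" and "det A \<noteq> 0" "\<gamma> \<in> SL2_Z" "\<delta> \<in> SL2_Z"
    and P0: "P0 ** swap_planes = B ** P0 ** sp_times w w'" and "w \<in> SL2_Z" "w' \<in> SL2_Z"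
    and "\<bar>det B\<bar> = 1"
  shows "\<exists>B \<gamma> \<delta>. \<bar>det B\<bar> = 1 \<and> \<gamma> \<in> SL2_Z \<and> \<delta> \<in> SL2_Z \<and>
    P ** swap_planes = B ** P ** sp_times \<gamma> \<delta>"
proof -
  obtain A' where A': "A' ** A = mat 1" "det A' = inverse (det A)"
    using det_nonzero_inverse[OF assms(2)] by blast
  obtain \<gamma>' where g: "\<gamma>' \<in> SL2_Z" "\<gamma> ** \<gamma>' = mat 1"
    using SL2_Z_has_inverse[OF assms(3)] by blast
  obtain \<delta>' where d: "\<delta>' \<in> SL2_Z" "\<delta> ** \<delta>' = mat 1"
    using SL2_Z_has_inverse[OF assms(4)] by blast
  have "(A ** B ** A') ** P ** sp_times (\<gamma>' ** w ** \<delta>) (\<delta>' ** w' ** \<gamma>)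
    = A ** B ** (A' ** A) ** P0 **
       (sp_times \<gamma> \<delta> ** sp_times (\<gamma>' ** w ** \<delta>) (\<delta>' ** w' ** \<gamma>))"
    by (simp only: P matrix_mul_assoc)
  also have "\<dots> = A ** B ** P0 ** sp_times (w ** \<delta>) (w' ** \<gamma>)"
    by (simp add: A' sp_times_mult matrix_mul_assoc g d)
  also have "\<dots> = A ** (B ** P0 ** sp_times w w') ** sp_times \<delta> \<gamma>"
    by (simp only: sp_times_mult flip: matrix_mul_assoc)
  also have "\<dots> = A ** P0 ** (swap_planes ** sp_times \<delta> \<gamma>)"
    by (simp only: P0[symmetric] matrix_mul_assoc)
  also have "\<dots> = P ** swap_planes"
    by (simp only: P sp_times_swap[symmetric] matrix_mul_assoc)
  finally have "P ** swap_planes =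
    (A ** B ** A') ** P ** sp_times (\<gamma>' ** w ** \<delta>) (\<delta>' ** w' ** \<gamma>)" ..
  moreover have "\<bar>det (A ** B ** A')\<bar> = 1"
    using assms by (simp add: det_mul A' abs_mult)
  moreover have "\<gamma>' ** w ** \<delta> \<in> SL2_Z" "\<delta>' ** w' ** \<gamma> \<in> SL2_Z"
    using assms g d by (simp_all add: SL2_Z_mult)
  ultimately show ?thesis by blast
qed

lemma lagrangian_swap:
  assumes "proportional_integral P" "proportional_integral Q" "det P + det Q = 0"
    and "\<And>A :: real^2^2. A ** interleave P Q = 0 \<Longrightarrow> A = 0"
  shows "\<exists>B \<gamma> \<delta>. \<bar>det B\<bar> = 1 \<and> \<gamma> \<in> SL2_Z \<and> \<delta> \<in> SL2_Z \<and>
    interleave P Q ** swap_planes = B ** interleave P Q ** sp_times \<gamma> \<delta>"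
proof (rule lagrangian_normal_form[OF assms], assumption, goal_cases lines graph)
  case (lines A \<gamma> \<delta>)
  have "interleave (mat2 0 1 0 0) (mat2 0 0 0 1) ** swap_planes =
    mat2 0 1 1 0 ** interleave (mat2 0 1 0 0) (mat2 0 0 0 1) ** sp_times (mat 1) (mat 1)"
    by (simp add: interleave_mult_swap_planes mult_interleave sp_times_1)
  then show ?thesis
    by (rule swap_planes_conjugation[OF lines(4,1,2,3)]) (auto simp: mat_1_in_SL2_Z)
next
  case (graph A \<gamma> \<delta> x y)
  \<comment> \<open>The two quarter turns are inverse to each other. The relation
    \<open>x * y = -1\<close> enters in the second plane, where the product has to be the identity,
    and in the determinant \<open>x * y\<close> of the left factor.\<close>
  have "interleave (mat 1) (mat2 x 0 0 y) ** swap_planes =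
    mat2 0 x (- y) 0 ** interleave (mat 1) (mat2 x 0 0 y) ** sp_times (imat 0 (-1) 1 0) (imat 0 1 (-1) 0)"
    using graph(4) by (simp add: interleave_mult_swap_planes mult_interleave mat_eq_mat2
        interleave_mult_sp_times mult.commute)
  then show ?thesis
    by (rule swap_planes_conjugation[OF graph(5,1,2,3)]; (subst imat_in_SL2_Z)?) (use graph(4) in auto)
qed

section \<open>Comparison of automorphy factors\<close>

text \<open>The maximal compact subgroup, a copy of U(2); it acts transitively on the Lagrangian
  planes.\<close>

definition orthogonal_Sp2 :: "(real^(2 + 2)^(2 + 2)) set"
  where "orthogonal_Sp2 = {k \<in> Sp2_R. k ** transpose k = mat 1}"

lemma compact_orthogonal_Sp2: "compact orthogonal_Sp2"
proof -
  have cl: "closed {k :: real^(2 + 2)^(2 + 2). transpose k ** symplectic_form ** k = symplectic_form}"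
    "closed {k :: real^(2 + 2)^(2 + 2). k ** transpose k = mat 1}"
    unfolding matrix_matrix_mult_def transpose_def
    by (intro closed_Collect_eq continuous_intros)+
  have eq: "orthogonal_Sp2 =
    {k. transpose k ** symplectic_form ** k = symplectic_form} \<inter> {k. k ** transpose k = mat 1}"
    unfolding orthogonal_Sp2_def Sp2_R_def by blast
  have "closed orthogonal_Sp2"
    unfolding eq by (rule closed_Int[OF cl])
  moreover have "norm k \<le> (\<Sum>i\<in>(UNIV::(2+2) set). 1)" if "k \<in> orthogonal_Sp2" for k
  proof -
    have row: "norm (k $ i) = 1" for i
    proof -
      have "k $ i \<bullet> k $ i = (k ** transpose k) $ i $ i"
        by (simp add: inner_vec_def matrix_matrix_mult_def transpose_def)
      also have "\<dots> = 1"
        using that by (simp add: orthogonal_Sp2_def mat_def)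
      finally show ?thesis
        by (simp add: norm_eq_sqrt_inner)
    qed
    have "norm k \<le> (\<Sum>i\<in>UNIV. norm (k $ i))"
      unfolding norm_vec_def[of k] by (rule L2_set_le_sum) simp
    then show ?thesis
      by (simp only: row)
  qed
  then have "bounded orthogonal_Sp2"
    unfolding bounded_iff by blast
  ultimately show ?thesis
    by (simp add: compact_eq_bounded_closed)
qed

lemma continuous_on_lag_det:
  "continuous_on UNIV (\<lambda>k. lag_det Z (lower_half (k ** h)))"
  unfolding lag_det_def det_2 lower_half_def left_right_beside block_C_def block_D_def
    matrix_matrix_mult_def map_matrix_def
  by (simp, intro continuous_intros)

text \<open>The two summands are the squared absolute values of the automorphy factor of
  \<open>(C, D)\<close> at \<open>\<i>\<close> and of the symplectic product of its two rows.\<close>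

lemma gram_det:
  fixes C D :: "real^2^2"
  shows "det (C ** transpose C + D ** transpose D) = (cmod (lag_det (mat \<i>) (beside C D)))\<^sup>2 +
    ((C ** transpose D) $ 1 $ 2 - (D ** transpose C) $ 1 $ 2)\<^sup>2"
proof -
  obtain c1 c2 c3 c4 where C: "C = mat2 c1 c2 c3 c4" by (rule mat2_cases)
  obtain d1 d2 d3 d4 where D: "D = mat2 d1 d2 d3 d4" by (rule mat2_cases)
  have "cmat C ** mat \<i> + cmat D =
    mat2 (Complex d1 c1) (Complex d2 c2) (Complex d3 c3) (Complex d4 c4)"
    by (simp add: C D vec_eq_iff forall_2 mat_eq_mat2 matrix_matrix_mult_def sum_2 complex_eq_iff)
  then have lag: "lag_det (mat \<i>) (beside C D) =
    Complex d1 c1 * Complex d4 c4 - Complex d2 c2 * Complex d3 c3"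
    unfolding lag_det_def left_right_beside by simp
  show ?thesis
    unfolding lag unfolding cmod_power2 C D mat2_transpose mat2_mult mat2_add mat2_det mat2_nth
    by (simp add: power2_eq_square algebra_simps)
qed

lemma imaginary_unit_in_siegel_H2: "mat \<i> \<in> siegel_H2"
proof -
  have "map_matrix Im (mat \<i> :: complex^2^2) = mat 1"
    by (simp add: vec_eq_iff mat_def)
  then show ?thesis
    by (simp add: siegel_H2_def positive_definite_def)
qed

lemma cholesky_inverse:
  fixes a b d :: real
  assumes "a \<ge> 0" "a * d - b\<^sup>2 > 0"
  obtains L where "det L \<noteq> 0" "L ** mat2 a b b d ** transpose L = mat 1"
proof -
  have "a > 0"
    using assms by (cases "a = 0") (auto simp: not_less)
  define u where "u = sqrt a"
  define v where "v = sqrt (a * d - b\<^sup>2)"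
  have uv: "u > 0" "v > 0" "a = u\<^sup>2" "a * d - b\<^sup>2 = v\<^sup>2"
    using \<open>a > 0\<close> assms by (simp_all add: u_def v_def)
  have d: "d = (v\<^sup>2 + b\<^sup>2) / u\<^sup>2"
    using uv by (simp add: field_simps)
  \<comment> \<open>The inverse of the Cholesky factor, whose rows are \<open>(u, 0)\<close> and
    \<open>(b / u, v / u)\<close>.\<close>
  let ?L = "mat2 (1 / u) 0 (- b / (u * v)) (u / v)"
  have "?L ** mat2 a b b d ** transpose ?L = mat 1"
    unfolding d \<open>a = u\<^sup>2\<close> using uv(1,2)
    by (simp add: mat_eq_mat2 power2_eq_square field_simps)
  moreover have "det ?L \<noteq> 0"
    using uv by simp
  ultimately show thesis
    using that by blast
qed

text \<open>Orthonormalising the rows of \<open>(C, D)\<close> by \<open>L\<close> gives an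
  isotropic orthonormal pair, which is the lower half of an orthogonal symplectic matrix. The Gram
  determinant is positive because on a Lagrangian it is the squared modulus of the automorphy factor
  at \<open>mat \<i>\<close>.\<close>

lemma iwasawa_lower_half:
  assumes "g \<in> Sp2_R"
  obtains A k where "det A \<noteq> 0" "k \<in> orthogonal_Sp2" "lower_half g = A ** lower_half k"
proof -
  obtain A B C D where g: "g = block_matrix A B C D" by (rule block_matrix_cases)
  have sym: "C ** transpose D = D ** transpose C"
    using assms by (simp add: g block_matrix_in_Sp2_R_iff)
  define G where "G = C ** transpose C + D ** transpose D"
  have "lag_det (mat \<i>) (beside C D) \<noteq> 0"
    using aut_factor_nonzero[OF assms imaginary_unit_in_siegel_H2] by (simp add: aut_factor_eq g)
  then have det: "det G > 0"
    unfolding G_def gram_det sym by simp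
  obtain a b b' d where G: "G = mat2 a b b' d" by (rule mat2_cases)
  have "transpose G = G"
    by (simp add: G_def transpose_add matrix_transpose_mul)
  then have b': "b' = b"
    unfolding G mat2_transpose mat2_eq_iff by blast
  have "a = G $ 1 $ 1" by (simp add: G)
  then have "a \<ge> 0"
    by (simp add: G_def matrix_matrix_mult_def transpose_def sum_2)
  moreover have "a * d - b\<^sup>2 > 0"
    using det by (simp add: G b' power2_eq_square)
  ultimately obtain L where L: "det L \<noteq> 0" "L ** G ** transpose L = mat 1"
    unfolding G b' by (rule cholesky_inverse)
  let ?k = "block_matrix (L ** D) (- (L ** C)) (L ** C) (L ** D)"
  have LL: "(L ** C) ** transpose (L ** C) + (L ** D) ** transpose (L ** D) = mat 1"
    unfolding L(2)[symmetric] G_def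
    by (simp add: matrix_distribs matrix_transpose_mul matrix_mul_assoc)
  have LS: "(L ** C) ** transpose (L ** D) = (L ** D) ** transpose (L ** C)"
  proof -
    have "(L ** C) ** transpose (L ** D) = L ** (C ** transpose D) ** transpose L"
      by (simp only: matrix_transpose_mul matrix_mul_assoc)
    also have "\<dots> = (L ** D) ** transpose (L ** C)"
      by (simp only: sym matrix_transpose_mul matrix_mul_assoc)
    finally show ?thesis .
  qed
  have tr: "transpose (- X) = - transpose X" for X :: "real^2^2"
    by (simp add: transpose_def vec_eq_iff)
  have "?k \<in> Sp2_R"
    unfolding block_matrix_in_Sp2_R_iff tr matrix_mult_uminus LS using LL by (simp add: add.commute)
  moreover have "?k ** transpose ?k = mat 1"
    unfolding block_matrix_transpose block_matrix_mult tr matrix_mult_uminus LS mat_1_block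
    using LL by (simp add: add.commute)
  ultimately have k: "?k \<in> orthogonal_Sp2"
    by (simp add: orthogonal_Sp2_def)
  obtain L' where L': "L' ** L = mat 1" "L ** L' = mat 1"
    using det_nonzero_inverse[OF L(1)] by blast
  have "lower_half g = L' ** lower_half ?k"
    by (simp add: g mult_beside matrix_mul_assoc L')
  moreover have "det L' \<noteq> 0"
    using L'(1) by (rule det_mult_eq_1D)
  ultimately show thesis
    using that k by blast
qed

text \<open>In the quotient of the two factors the determinant of a change of basis cancels, so the
  quotient depends only on the Lagrangian plane of \<open>g\<close> and is bounded by compactness.
  The bound for the pairs \<open>(h, mat 1)\<close> and \<open>(mat 1, h)\<close> gives both
  inequalities.\<close>

lemma lag_det_comparison:
  assumes "h \<in> Sp2_R" "Z \<in> siegel_H2"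
  obtains c where "c > 0"
    "\<And>g. g \<in> Sp2_R \<Longrightarrow> cmod (aut_factor (g ** h) Z) \<le> c * cmod (aut_factor g Z)"
    "\<And>g. g \<in> Sp2_R \<Longrightarrow> cmod (aut_factor g Z) \<le> c * cmod (aut_factor (g ** h) Z)"
proof -
  let ?f = "\<lambda>h k. lag_det Z (lower_half (k ** h))"
  have nz: "?f h k \<noteq> 0" if "k \<in> Sp2_R" "h \<in> Sp2_R" for h k
    using aut_factor_nonzero[OF Sp2_R_mult[OF that] assms(2)] by (simp add: aut_factor_eq)
  have bound: "\<exists>c>0. \<forall>g\<in>Sp2_R. cmod (?f h g) \<le> c * cmod (?f h' g)"
    if "h \<in> Sp2_R" "h' \<in> Sp2_R" for h h'
  proof -
    have "continuous_on orthogonal_Sp2 (\<lambda>k. ?f h k / ?f h' k)"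
    proof (rule continuous_on_divide)
      show "continuous_on orthogonal_Sp2 (?f h)" "continuous_on orthogonal_Sp2 (?f h')"
        by (rule continuous_on_subset[OF continuous_on_lag_det subset_UNIV])+
      show "\<forall>k\<in>orthogonal_Sp2. ?f h' k \<noteq> 0"
        using nz that by (auto simp: orthogonal_Sp2_def)
    qed
    then have "compact ((\<lambda>k. ?f h k / ?f h' k) ` orthogonal_Sp2)"
      by (rule compact_continuous_image) (rule compact_orthogonal_Sp2)
    then have "bounded ((\<lambda>k. ?f h k / ?f h' k) ` orthogonal_Sp2)"
      by (rule compact_imp_bounded)
    then obtain c where c: "c > 0" "\<And>k. k \<in> orthogonal_Sp2 \<Longrightarrow> cmod (?f h k / ?f h' k) \<le> c"
      unfolding bounded_pos ball_simps by blast
    have "cmod (?f h g) \<le> c * cmod (?f h' g)" if g: "g \<in> Sp2_R" for g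
    proof -
      obtain A k where *: "det A \<noteq> 0" "k \<in> orthogonal_Sp2" "lower_half g = A ** lower_half k"
        using g by (rule iwasawa_lower_half)
      have k: "cmod (?f h k) \<le> c * cmod (?f h' k)"
        using c(2)[OF *(2)] nz[of k h'] *(2) \<open>h' \<in> Sp2_R\<close>
        by (auto simp: orthogonal_Sp2_def norm_divide divide_simps split: if_splits)
      have "?f h g = of_real (det A) * ?f h k" for h
        by (simp add: lower_half_mult *(3) lag_det_mult flip: matrix_mul_assoc)
      then show ?thesis
        using k mult_left_mono[OF k, of "\<bar>det A\<bar>"] by (simp add: norm_mult mult_ac)
    qed
    then show ?thesis
      using c(1) by blast
  qed
  obtain c where c: "c > 0" "\<And>g. g \<in> Sp2_R \<Longrightarrow> cmod (?f h g) \<le> c * cmod (?f (mat 1) g)"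
    using bound[OF assms(1) mat_1_in_Sp2_R] by blast
  obtain c' where c': "c' > 0" "\<And>g. g \<in> Sp2_R \<Longrightarrow> cmod (?f (mat 1) g) \<le> c' * cmod (?f h g)"
    using bound[OF mat_1_in_Sp2_R assms(1)] by blast
  show thesis
  proof (rule that[of "max c c'"])
    show "cmod (aut_factor (g ** h) Z) \<le> max c c' * cmod (aut_factor g Z)" if "g \<in> Sp2_R" for g
      using c(2)[OF that] by (smt (verit) aut_factor_eq matrix_mul_rid mult_right_mono norm_ge_zero)
    show "cmod (aut_factor g Z) \<le> max c c' * cmod (aut_factor (g ** h) Z)" if "g \<in> Sp2_R" for g
      using c'(2)[OF that] by (smt (verit) aut_factor_eq matrix_mul_rid mult_right_mono norm_ge_zero)
  qed (use c in auto)
qed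

section \<open>The slash action on the Eisenstein series\<close>

definition scaling_weight :: "int \<Rightarrow> complex \<Rightarrow> real \<Rightarrow> complex"
  where "scaling_weight k s a = of_real a powi (- k) * of_real (1 / a\<^sup>2) powr s"

text \<open>The Eisenstein summand as a function of the automorphy factor \<open>x\<close>, with the
  imaginary part of the image rewritten by its transformation law.\<close>

definition eis_term :: "int \<Rightarrow> complex \<Rightarrow> complex^2^2 \<Rightarrow> complex \<Rightarrow> complex"
  where "eis_term k s Z x = x powi (- k) * of_real (im_det Z / (cmod x)\<^sup>2) powr s"

text \<open>Here \<open>1 / 0 = 0\<close> and \<open>0 powr s = 0\<close>, so the value is
  \<open>0\<close> even for \<open>k = 0\<close>, where the power factor is 1. A plane whose index
  has the default value \<open>0\<close> therefore contributes nothing.\<close>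

lemma scaling_weight_0 [simp]: "scaling_weight k s 0 = 0"
  by (simp add: scaling_weight_def)

lemma eis_term_scale:
  assumes "even k"
  shows "eis_term k s Z (of_real r * x) = scaling_weight k s \<bar>r\<bar> * eis_term k s Z x"
proof -
  have "of_real (im_det Z / (cmod (of_real r * x))\<^sup>2) powr s =
    (of_real (1 / r\<^sup>2) * of_real (im_det Z / (cmod x)\<^sup>2)) powr s"
    by (simp add: norm_mult power_mult_distrib)
  also have "\<dots> = of_real (1 / r\<^sup>2) powr s * of_real (im_det Z / (cmod x)\<^sup>2) powr s"
    by (rule powr_times_real_left) auto
  finally have 1: "of_real (im_det Z / (cmod (of_real r * x))\<^sup>2) powr s = \<dots>" .
  have "of_real r powi (- k) = (of_real \<bar>r\<bar> powi (- k) :: complex)"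
    using assms by (auto simp: abs_if power_int_minus_left)
  then show ?thesis
    unfolding eis_term_def 1 scaling_weight_def
    by (simp add: power_int_mult_distrib)
qed

lemma norm_scaling_weight:
  assumes "a > 0"
  shows "cmod (scaling_weight k s a) = a powr (- of_int k - 2 * Re s)"
proof -
  have "cmod (of_real (1 / a\<^sup>2) powr s) = (1 / a\<^sup>2) powr Re s"
    by (subst norm_powr_real_powr) auto
  also have "\<dots> = (a powr (-2)) powr Re s"
    using assms by (simp add: powr_minus powr_numeral divide_inverse)
  also have "\<dots> = a powr (- 2 * Re s)"
    by (simp add: powr_powr)
  finally have "cmod (of_real (1 / a\<^sup>2) powr s) = a powr (- 2 * Re s)" .
  moreover have "cmod (of_real a powi (- k)) = a powr (- of_int k)"
    using assms powr_real_of_int'[of a "- k"] by (simp add: norm_power_int)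
  ultimately show ?thesis
    by (simp add: scaling_weight_def norm_mult flip: powr_add)
qed

text \<open>Up to a phase, \<open>x\<close> is \<open>a * y\<close> with
  \<open>1 / c \<le> a \<le> c\<close>, and the norm changes by \<open>a powr e\<close>. Adding the
  values at both ends of the interval bounds this for either sign of \<open>e\<close>.\<close>

lemma norm_eis_term_le:
  fixes k :: int and s :: complex
  assumes "even k" "c > 0" "x \<noteq> 0" "cmod x \<le> c * cmod y" "cmod y \<le> c * cmod x"
  defines "e \<equiv> - of_int k - 2 * Re s"
  shows "cmod (eis_term k s Z x) \<le> (c powr e + (1 / c) powr e) * cmod (eis_term k s Z y)"
proof -
  have "y \<noteq> 0"
    using assms by auto
  define a where "a = cmod x / cmod y"
  have a: "a > 0" "a \<le> c" "1 / c \<le> a"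
    using assms \<open>y \<noteq> 0\<close> by (simp_all add: a_def field_simps)
  have "cmod (of_real a * y) = a * cmod y"
    using a(1) by (simp add: norm_mult)
  also have "\<dots> = cmod x"
    using \<open>y \<noteq> 0\<close> by (simp add: a_def)
  finally have "cmod (of_real a * y) = cmod x" .
  then have "cmod (eis_term k s Z x) = cmod (eis_term k s Z (of_real a * y))"
    by (simp add: eis_term_def norm_mult[of "_ powi _"] norm_power_int)
  also have "\<dots> = a powr e * cmod (eis_term k s Z y)"
    using a(1) by (simp add: eis_term_scale[OF assms(1)] norm_mult norm_scaling_weight e_def)
  finally have eq: "cmod (eis_term k s Z x) = a powr e * cmod (eis_term k s Z y)" .
  have "a powr e \<le> c powr e + (1 / c) powr e"
  proof (cases "e \<ge> 0")
    case True
    then have "a powr e \<le> c powr e"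
      using a by (intro powr_mono2) auto
    then show ?thesis
      by (smt (verit) powr_ge_zero)
  next
    case False
    then have "a powr e \<le> (1 / c) powr e"
      using a assms by (intro powr_mono2') auto
    then show ?thesis
      by (smt (verit) powr_ge_zero)
  qed
  then show ?thesis
    unfolding eq by (intro mult_right_mono norm_ge_zero)
qed

lemma coset_rep_in:
  assumes "c \<in> left_cosets G M" "mat 1 \<in> G"
  shows "coset_rep c \<in> c"
proof -
  obtain t where "c = (\<lambda>\<gamma>. \<gamma> ** t) ` G"
    using assms(1) by (auto simp: left_cosets_def)
  then have "mat 1 ** t \<in> c"
    using assms(2) by blast
  then show ?thesis
    unfolding coset_rep_def by (rule someI)
qed

lemma mat_1_in_Sp2_Z0: "mat 1 \<in> Sp2_Z0"
  using mat_1_in_Sp2_Z by (simp add: Sp2_Z0_def block_C_def mat_def vec_eq_iff)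

lemma coset_rep_in_Sp2_Z:
  assumes "c \<in> left_cosets Sp2_Z0 Sp2_Z"
  shows "coset_rep c \<in> Sp2_Z"
proof -
  obtain t where "t \<in> Sp2_Z" "c = (\<lambda>\<gamma>. \<gamma> ** t) ` Sp2_Z0"
    using assms by (auto simp: left_cosets_def)
  then have "c \<subseteq> Sp2_Z"
    by (auto simp: Sp2_Z0_def Sp2_Z_mult)
  then show ?thesis
    using coset_rep_in[OF assms mat_1_in_Sp2_Z0] by blast
qed

lemma slash_eisenstein:
  assumes "h \<in> Sp2_R" "Z \<in> siegel_H2"
  shows "slash k (eisenstein k s) h Z =
    (\<Sum>\<^sub>\<infinity>c\<in>left_cosets Sp2_Z0 Sp2_Z. eis_term k s Z (aut_factor (coset_rep c ** h) Z))"
  unfolding slash_def eisenstein_def infsum_cmult_right'[symmetric]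
proof (rule infsum_cong)
  fix c assume "c \<in> left_cosets Sp2_Z0 Sp2_Z"
  then have g: "coset_rep c \<in> Sp2_R"
    using coset_rep_in_Sp2_Z by (auto simp: Sp2_Z_def)
  let ?g = "coset_rep c"
  have nz: "aut_factor h Z \<noteq> 0" "aut_factor (?g ** h) Z \<noteq> 0"
    using aut_factor_nonzero Sp2_R_mult assms g by blast+
  have "im_det (sp_act ?g (sp_act h Z)) = im_det Z / (cmod (aut_factor (?g ** h) Z))\<^sup>2"
    using im_det_sp_act[OF Sp2_R_mult[OF g assms(1)] assms(2)] sp_act_mult[OF nz] by simp
  then show "aut_factor h Z powi - k *
         (aut_factor ?g (sp_act h Z) powi - k *
          complex_of_real (im_det (sp_act ?g (sp_act h Z))) powr s) =
         eis_term k s Z (aut_factor (?g ** h) Z)"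
    by (simp add: eis_term_def aut_factor_cocycle[OF nz(1)] power_int_mult_distrib mult_ac)
qed

text \<open>Complex summability is absolute summability, and by the comparison of automorphy factors
  the norms of the two families bound each other up to a constant.\<close>

lemma summable_slash_eisenstein:
  assumes "even k" "h \<in> Sp2_R" "Z \<in> siegel_H2"
  defines "S \<equiv> left_cosets Sp2_Z0 Sp2_Z"
  shows "(\<lambda>c. eis_term k s Z (aut_factor (coset_rep c ** h) Z)) summable_on S \<longleftrightarrow>
    (\<lambda>c. eis_term k s Z (aut_factor (coset_rep c) Z)) summable_on S"
proof -
  let ?e = "- of_int k - 2 * Re s"
  obtain C where C: "C > 0"
    "\<And>g. g \<in> Sp2_R \<Longrightarrow> cmod (aut_factor (g ** h) Z) \<le> C * cmod (aut_factor g Z)"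
    "\<And>g. g \<in> Sp2_R \<Longrightarrow> cmod (aut_factor g Z) \<le> C * cmod (aut_factor (g ** h) Z)"
    using assms(2,3) by (rule lag_det_comparison) blast
  let ?M = "C powr ?e + (1 / C) powr ?e"
  have bound: "(\<lambda>x. cmod (f x)) summable_on S" if "(\<lambda>x. cmod (g x)) summable_on S"
    "\<And>x. x \<in> S \<Longrightarrow> cmod (f x) \<le> ?M * cmod (g x)" for f g
  proof (rule Infinite_Sum.abs_summable_on_comparison_test)
    show "(\<lambda>x. cmod (of_real ?M * g x)) summable_on S"
      using that(1) by (simp add: norm_mult summable_on_cmult_right)
    show "cmod (f x) \<le> cmod (of_real ?M * g x)" if "x \<in> S" for x
    proof -
      have "cmod (of_real ?M * g x) = ?M * cmod (g x)"
        unfolding norm_mult norm_of_real by simp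
      then show ?thesis
        using \<open>x \<in> S \<Longrightarrow> cmod (f x) \<le> ?M * cmod (g x)\<close> that by simp
    qed
  qed
  have rep: "coset_rep c \<in> Sp2_R" if "c \<in> S" for c
    using coset_rep_in_Sp2_Z that by (auto simp: Sp2_Z_def S_def)
  have nz: "aut_factor (coset_rep c) Z \<noteq> 0" "aut_factor (coset_rep c ** h) Z \<noteq> 0" if "c \<in> S" for c
    using aut_factor_nonzero rep[OF that] Sp2_R_mult assms by blast+
  show ?thesis
    unfolding summable_on_iff_abs_summable_on_complex
  proof
    assume "(\<lambda>c. cmod (eis_term k s Z (aut_factor (coset_rep c ** h) Z))) summable_on S"
    then show "(\<lambda>c. cmod (eis_term k s Z (aut_factor (coset_rep c) Z))) summable_on S"
      by (rule bound) (use C rep nz assms(1) in \<open>auto intro!: norm_eis_term_le\<close>)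
  next
    assume "(\<lambda>c. cmod (eis_term k s Z (aut_factor (coset_rep c) Z))) summable_on S"
    then show "(\<lambda>c. cmod (eis_term k s Z (aut_factor (coset_rep c ** h) Z))) summable_on S"
      by (rule bound) (use C rep nz assms(1) in \<open>auto intro!: norm_eis_term_le\<close>)
  qed
qed

section \<open>Cosets of matrix groups\<close>

definition matrix_group :: "(real^'n^'n) set \<Rightarrow> bool"
  where "matrix_group G \<longleftrightarrow> mat 1 \<in> G \<and> (\<forall>g\<in>G. \<forall>h\<in>G. g ** h \<in> G) \<and>
    (\<forall>g\<in>G. \<exists>g'\<in>G. g' ** g = mat 1 \<and> g ** g' = mat 1)"

lemma coset_image_eq:
  assumes "matrix_group G" "p \<in> G"
  shows "(\<lambda>\<gamma>. \<gamma> ** (p ** t)) ` G = (\<lambda>\<gamma>. \<gamma> ** t) ` G"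
proof (intro equalityI subsetI)
  fix x assume "x \<in> (\<lambda>\<gamma>. \<gamma> ** (p ** t)) ` G"
  then obtain \<gamma> where "\<gamma> \<in> G" "x = (\<gamma> ** p) ** t"
    by (auto simp: matrix_mul_assoc)
  then show "x \<in> (\<lambda>\<gamma>. \<gamma> ** t) ` G"
    using assms unfolding matrix_group_def by blast
next
  fix x assume "x \<in> (\<lambda>\<gamma>. \<gamma> ** t) ` G"
  then obtain \<gamma> where g: "\<gamma> \<in> G" "x = \<gamma> ** t"
    by blast
  obtain p' where p': "p' \<in> G" "p' ** p = mat 1"
    using assms unfolding matrix_group_def by blast
  have "x = (\<gamma> ** p') ** (p ** t)"
  proof -
    have "(\<gamma> ** p') ** (p ** t) = \<gamma> ** (p' ** p) ** t"
      by (simp only: matrix_mul_assoc)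
    then show ?thesis by (simp add: p' g)
  qed
  moreover have "\<gamma> ** p' \<in> G"
    using assms g p' unfolding matrix_group_def by blast
  ultimately show "x \<in> (\<lambda>\<gamma>. \<gamma> ** (p ** t)) ` G"
    by blast
qed

lemma coset_eq_rep:
  assumes "matrix_group G" "c \<in> left_cosets G M"
  shows "c = (\<lambda>\<gamma>. \<gamma> ** coset_rep c) ` G"
proof -
  obtain t where c: "c = (\<lambda>\<gamma>. \<gamma> ** t) ` G"
    using assms(2) by (auto simp: left_cosets_def)
  have "coset_rep c \<in> c"
    using coset_rep_in assms by (auto simp: matrix_group_def)
  then obtain p where "p \<in> G" "coset_rep c = p ** t"
    using c by auto
  then show ?thesis
    using coset_image_eq[OF assms(1)] c by metis
qed

lemma matrix_group_SL2_Z: "matrix_group SL2_Z"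
  unfolding matrix_group_def using mat_1_in_SL2_Z SL2_Z_mult SL2_Z_has_inverse by metis

lemma Sp2_Z0_cases:
  assumes "p \<in> Sp2_Z0"
  obtains A B D where "p = block_matrix A B 0 D" "A ** transpose D = mat 1" "p \<in> Sp2_Z"
proof -
  obtain A B C D where p: "p = block_matrix A B C D" by (rule block_matrix_cases)
  have "p \<in> Sp2_Z" "C = 0"
    using assms by (auto simp: Sp2_Z0_def p)
  moreover from this have "A ** transpose D = mat 1"
    by (simp add: Sp2_Z_def p block_matrix_in_Sp2_R_iff transpose_def vec_eq_iff
        matrix_matrix_mult_def)
  ultimately show thesis
    using that p by blast
qed

lemma matrix_group_Sp2_Z0: "matrix_group Sp2_Z0"
  unfolding matrix_group_def
proof (intro conjI ballI)
  show "mat 1 \<in> Sp2_Z0" by (rule mat_1_in_Sp2_Z0)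
  fix g assume g: "g \<in> Sp2_Z0"
  then obtain A B D where g': "g = block_matrix A B 0 D" "A ** transpose D = mat 1" "g \<in> Sp2_Z"
    by (rule Sp2_Z0_cases)
  show "g ** h \<in> Sp2_Z0" if "h \<in> Sp2_Z0" for h
  proof -
    obtain A' B' D' where "h = block_matrix A' B' 0 D'" "h \<in> Sp2_Z"
      using \<open>h \<in> Sp2_Z0\<close> by (rule Sp2_Z0_cases)
    then show ?thesis
      using g' Sp2_Z_mult[of g h] by (simp add: Sp2_Z0_def block_matrix_mult)
  qed
  obtain x where x: "x \<in> Sp2_Z" "x ** g = mat 1" "g ** x = mat 1"
    using Sp2_Z_has_inverse[OF g'(3)] .
  obtain A' B' C' D' where x': "x = block_matrix A' B' C' D'" by (rule block_matrix_cases)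
  have "C' ** A = 0"
    using x(2) by (simp add: x' g' block_matrix_mult mat_1_block)
  then have "C' ** (A ** transpose D) = 0"
    by (simp add: matrix_mul_assoc)
  then have "C' = 0"
    by (simp add: g')
  then have "x \<in> Sp2_Z0"
    using x(1) by (simp add: Sp2_Z0_def x')
  then show "\<exists>g'\<in>Sp2_Z0. g' ** g = mat 1 \<and> g ** g' = mat 1"
    using x by blast
qed

lemma lower_half_1: "lower_half (mat 1 :: real^(2 + 2)^(2 + 2)) = beside 0 (mat 1)"
  by (simp add: mat_1_block)

lemma lower_half_Sp2_Z0_mult:
  assumes "p \<in> Sp2_Z0"
  obtains B where "det B \<noteq> 0" "\<And>g. lower_half (p ** g) = B ** lower_half g"
proof -
  obtain A B D where p: "p = block_matrix A B 0 D" "A ** transpose D = mat 1"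
    using assms by (rule Sp2_Z0_cases)
  have "lower_half (p ** g) = D ** lower_half g" for g
  proof -
    have "D ** lower_half g = D ** (lower_half (mat 1) ** g)"
      by (simp flip: lower_half_mult)
    then show ?thesis
      by (simp add: lower_half_1 lower_half_mult p mult_beside matrix_mul_assoc)
  qed
  moreover have "det D \<noteq> 0"
    using arg_cong[OF p(2), of det] by (auto simp: det_mul)
  ultimately show thesis
    using that by blast
qed

lemma lower_half_cancel:
  assumes "h \<in> Sp2_R" "X ** lower_half h = Y ** lower_half h"
  shows "X = (Y :: real^2^2)"
proof -
  obtain h' where h': "h ** h' = mat 1"
    using Sp2_R_has_inverse[OF assms(1)] by blast
  have *: "X ** lower_half h ** h' = beside 0 X" for X
    unfolding matrix_mul_assoc[symmetric] lower_half_mult[symmetric] h' lower_half_1 mult_beside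
    by simp
  show ?thesis
    using *[of X] *[of Y] unfolding assms(2) by (metis beside_eq_iff)
qed

lemma integral_det: "integral_matrix (B :: real^2^2) \<Longrightarrow> det B \<in> \<int>"
  by (simp add: integral_matrix_def det_2)

text \<open>Both lower halves are bases of the same primitive sublattice of \<open>\<int>\<^sup>4\<close>.\<close>

lemma same_row_space:
  assumes "g \<in> Sp2_Z" "g' \<in> Sp2_Z" "det B \<noteq> 0" "lower_half g' = B ** lower_half g"
  shows "\<exists>p\<in>Sp2_Z0. g' = p ** g" "\<bar>det B\<bar> = 1"
proof -
  have base: "\<exists>p\<in>Sp2_Z. g' = p ** g \<and> block_C p = 0 \<and> block_D p = B"
    if gg': "g \<in> Sp2_Z" "g' \<in> Sp2_Z" "lower_half g' = B ** lower_half g"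
    for g g' and B :: "real^2^2"
  proof -
    obtain x where x: "x \<in> Sp2_Z" "x ** g = mat 1" "g ** x = mat 1"
      using Sp2_Z_has_inverse[OF gg'(1)] .
    have "lower_half (g' ** x) = B ** (lower_half g ** x)"
      by (simp add: lower_half_mult gg'(3) matrix_mul_assoc)
    also have "\<dots> = beside 0 B"
      by (simp add: x lower_half_1 mult_beside flip: lower_half_mult)
    finally have "block_C (g' ** x) = 0 \<and> block_D (g' ** x) = B"
      by (simp add: lower_half_def)
    moreover have "g' = (g' ** x) ** g"
      by (simp add: x flip: matrix_mul_assoc)
    ultimately show ?thesis
      using Sp2_Z_mult[OF gg'(2) x(1)] by blast
  qed
  \<comment> \<open>\<open>B\<close> is a block of \<open>g'\<close> times the inverse of
    \<open>g\<close>. With the roles exchanged the inverse of \<open>B\<close> is integral too, so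
    \<open>det B\<close> is a unit.\<close>
  have integral: "integral_matrix B"
    if gg': "g \<in> Sp2_Z" "g' \<in> Sp2_Z" "lower_half g' = B ** lower_half g"
    for g g' and B :: "real^2^2"
  proof -
    obtain p where "p \<in> Sp2_Z" "block_D p = B"
      using base[OF gg'] by blast
    then show ?thesis
      by (auto simp: Sp2_Z_def integral_matrix_def block_D_def)
  qed
  show "\<exists>p\<in>Sp2_Z0. g' = p ** g"
    using base[OF assms(1,2,4)] by (auto simp: Sp2_Z0_def)
  obtain B' where B': "B' ** B = mat 1" "det B' = inverse (det B)"
    using det_nonzero_inverse[OF assms(3)] by blast
  have "lower_half g = B' ** lower_half g'"
    by (simp add: assms(4) matrix_mul_assoc B')
  then have "det B \<in> \<int>" "inverse (det B) \<in> \<int>"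
    using integral integral_det assms B' by metis+
  then obtain m n where mn: "det B = of_int m" "inverse (det B) = of_int n"
    by (auto elim!: Ints_cases)
  then have "of_int (m * n) = (1 :: real)"
    using assms(3) by (metis of_int_mult right_inverse)
  then have "m * n = 1"
    using of_int_eq_1_iff by blast
  then have "\<bar>m\<bar> = 1"
    by (metis abs_zmult_eq_1 abs_1)
  then show "\<bar>det B\<bar> = 1"
    using mn by (metis of_int_1 of_int_abs)
qed

section \<open>The index of a lattice in a Lagrangian\<close>

text \<open>A full rank matrix \<open>P\<close> is a basis of a Lagrangian \<open>L\<close>. If \<open>L\<close> is rational for the
  lattice spanned by the rows of \<open>h\<close>, then \<open>lagrangian_index h P\<close> is the covolume of the
  induced lattice in \<open>L\<close>, measured in the basis \<open>P\<close>; otherwise it is \<open>0\<close>.\<close>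

definition is_lagrangian_index ::
  "real^(2 + 2)^(2 + 2) \<Rightarrow> real^(2 + 2)^2 \<Rightarrow> real \<Rightarrow> bool"
  where "is_lagrangian_index h P a \<longleftrightarrow>
    (\<exists>\<gamma>\<in>Sp2_Z. \<exists>A. det A \<noteq> 0 \<and> lower_half (\<gamma> ** h) = A ** P \<and> a = \<bar>det A\<bar>)"

definition lagrangian_index :: "real^(2 + 2)^(2 + 2) \<Rightarrow> real^(2 + 2)^2 \<Rightarrow> real"
  where "lagrangian_index h P =
    (if \<exists>a. is_lagrangian_index h P a then SOME a. is_lagrangian_index h P a else 0)"

text \<open>Two lattice bases of the same plane differ by a matrix of determinant 1 or -1. That fact
  concerns integral lower halves, hence the cancellation of \<open>h\<close>.\<close>

lemma is_lagrangian_index_unique: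
  assumes "h \<in> Sp2_R" "is_lagrangian_index h P a" "is_lagrangian_index h P b"
  shows "a = b"
proof -
  obtain \<gamma> A where 1: "\<gamma> \<in> Sp2_Z" "det A \<noteq> 0" "lower_half (\<gamma> ** h) = A ** P" "a = \<bar>det A\<bar>"
    using assms(2) unfolding is_lagrangian_index_def by blast
  obtain \<delta> B where 2: "\<delta> \<in> Sp2_Z" "det B \<noteq> 0" "lower_half (\<delta> ** h) = B ** P" "b = \<bar>det B\<bar>"
    using assms(3) unfolding is_lagrangian_index_def by blast
  obtain A' where A': "A' ** A = mat 1" "det A' = inverse (det A)"
    using det_nonzero_inverse[OF 1(2)] by blast
  obtain h' where h': "h ** h' = mat 1"
    using Sp2_R_has_inverse[OF assms(1)] by blast
  have "B ** A' ** lower_half (\<gamma> ** h) = B ** (A' ** A) ** P"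
    by (simp only: 1 matrix_mul_assoc)
  then have "lower_half (\<delta> ** h) = B ** A' ** lower_half (\<gamma> ** h)"
    by (simp add: A' 2)
  then have "lower_half (\<delta> ** h ** h') = B ** A' ** lower_half (\<gamma> ** h ** h')"
    by (simp add: lower_half_mult[of _ h'] matrix_mul_assoc)
  then have "lower_half \<delta> = B ** A' ** lower_half \<gamma>"
    by (simp add: h' flip: matrix_mul_assoc)
  moreover have "det (B ** A') \<noteq> 0"
    using 1 2 by (simp add: det_mul A')
  ultimately have "\<bar>det (B ** A')\<bar> = 1"
    using same_row_space(2) 1 2 by blast
  then show ?thesis
    using 1 2 by (simp add: det_mul A' abs_mult abs_inverse field_simps)
qed

lemma lagrangian_index_eqI:
  assumes "h \<in> Sp2_R" "is_lagrangian_index h P a"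
  shows "lagrangian_index h P = a"
  using assms is_lagrangian_index_unique unfolding lagrangian_index_def by (metis someI)

lemma lagrangian_index_cong:
  assumes "is_lagrangian_index h P = is_lagrangian_index h' P'"
  shows "lagrangian_index h P = lagrangian_index h' P'"
  unfolding lagrangian_index_def assms ..

lemma is_lagrangian_index_Sp2_Z_mult:
  assumes "\<delta> \<in> Sp2_Z"
  shows "is_lagrangian_index (\<delta> ** h) P = is_lagrangian_index h P"
proof (rule ext)
  fix a
  obtain \<delta>' where d: "\<delta>' \<in> Sp2_Z" "\<delta>' ** \<delta> = mat 1"
    using Sp2_Z_has_inverse[OF assms] by blast
  have imp: "is_lagrangian_index h P a" if asm: "is_lagrangian_index (\<delta> ** h) P a" "\<delta> \<in> Sp2_Z" for \<delta> h
  proof -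
    obtain \<gamma> A where "\<gamma> \<in> Sp2_Z" "det A \<noteq> 0" "lower_half ((\<gamma> ** \<delta>) ** h) = A ** P" "a = \<bar>det A\<bar>"
      using asm(1) by (auto simp: is_lagrangian_index_def matrix_mul_assoc)
    then show ?thesis
      using Sp2_Z_mult[OF _ asm(2)] unfolding is_lagrangian_index_def by blast
  qed
  have "\<delta>' ** (\<delta> ** h) = h"
    by (simp add: matrix_mul_assoc d)
  then show "is_lagrangian_index (\<delta> ** h) P a = is_lagrangian_index h P a"
    using imp[of \<delta> h] imp[of \<delta>' "\<delta> ** h"] assms d by auto
qed

lemma is_lagrangian_index_mult_right:
  assumes "x ** x' = mat 1"
  shows "is_lagrangian_index (h ** x) (P ** x) = is_lagrangian_index h P"
proof -
  have "lower_half (\<gamma> ** (h ** x)) = A ** (P ** x) \<longleftrightarrow> lower_half (\<gamma> ** h) = A ** P" for \<gamma> A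
  proof -
    have "lower_half (\<gamma> ** (h ** x)) = lower_half (\<gamma> ** h) ** x"
      by (simp add: lower_half_mult matrix_mul_assoc)
    moreover have "X ** x = Y ** x \<longleftrightarrow> X = Y" for X Y :: "real^(2+2)^2"
      by (metis assms matrix_mul_assoc matrix_mul_rid)
    ultimately show ?thesis
      by (simp add: matrix_mul_assoc)
  qed
  then show ?thesis
    unfolding is_lagrangian_index_def by presburger
qed

lemma is_lagrangian_index_mult_left:
  assumes "\<bar>det B\<bar> = 1"
  shows "is_lagrangian_index h (B ** P) = is_lagrangian_index h P"
proof (rule ext)
  fix a
  have imp: "is_lagrangian_index h P a" if asm: "is_lagrangian_index h (B ** P) a" "\<bar>det B\<bar> = 1" for B P
  proof -
    obtain \<gamma> A where 1: "\<gamma> \<in> Sp2_Z" "det A \<noteq> 0" "lower_half (\<gamma> ** h) = (A ** B) ** P" "a = \<bar>det A\<bar>"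
      using asm(1) by (auto simp: is_lagrangian_index_def matrix_mul_assoc)
    have "det (A ** B) \<noteq> 0" "a = \<bar>det (A ** B)\<bar>"
      using 1 asm(2) by (auto simp: det_mul abs_mult)
    then show ?thesis
      using 1 unfolding is_lagrangian_index_def by blast
  qed
  have "det B \<noteq> 0" using assms by auto
  then obtain B' where B': "B' ** B = mat 1" "det B' = inverse (det B)"
    by (rule det_nonzero_inverse)
  have "B' ** (B ** P) = P"
    by (simp add: matrix_mul_assoc B')
  moreover have "\<bar>det B'\<bar> = 1"
    using assms by (simp add: B' abs_inverse)
  ultimately show "is_lagrangian_index h (B ** P) a = is_lagrangian_index h P a"
    using imp[of B P] imp[of B' "B ** P"] assms by auto
qed

section \<open>Summation over Lagrangians\<close>

text \<open>A plane is encoded as the set of its bases. Degenerate matrices have a class as well,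
  but for symplectic \<open>h\<close> such a class carries no index.\<close>

definition row_class :: "real^(2 + 2)^2 \<Rightarrow> (real^(2 + 2)^2) set"
  where "row_class P = {A ** P | A. det A \<noteq> 0}"

definition row_basis :: "(real^(2 + 2)^2) set \<Rightarrow> real^(2 + 2)^2"
  where "row_basis L = (SOME P. P \<in> L)"

lemma row_class_mult:
  assumes "det B \<noteq> 0"
  shows "row_class (B ** P) = row_class P"
proof -
  have sub: "row_class (B ** P) \<subseteq> row_class P" if "det B \<noteq> 0" for B P
  proof
    fix X assume "X \<in> row_class (B ** P)"
    then obtain A where "det A \<noteq> 0" "X = (A ** B) ** P"
      by (auto simp: row_class_def matrix_mul_assoc)
    moreover from this have "det (A ** B) \<noteq> 0"
      using \<open>det B \<noteq> 0\<close> by (simp add: det_mul)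
    ultimately show "X \<in> row_class P"
      unfolding row_class_def by blast
  qed
  obtain B' where "B' ** B = mat 1" "det B' = inverse (det B)"
    using det_nonzero_inverse[OF assms] by blast
  then show ?thesis
    using sub[of B P] sub[of B' "B ** P"] assms by (simp add: matrix_mul_assoc)
qed

lemma row_class_self: "P \<in> row_class P"
  unfolding row_class_def by (rule CollectI, rule exI[of _ "mat 1"]) simp

lemma row_basis_in: "row_basis (row_class P) \<in> row_class P"
  unfolding row_basis_def using row_class_self by (rule someI)

lemma row_class_basis: "row_class (row_basis (row_class P)) = row_class P"
proof -
  obtain A where "det A \<noteq> 0" "row_basis (row_class P) = A ** P"
    using row_basis_in[of P] unfolding row_class_def by blast
  then show ?thesis
    by (simp add: row_class_mult)
qed

text \<open>The index measures the lattice against the chosen basis, so for even \<open>k\<close>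
  the dependence on that basis cancels between the two factors.\<close>

definition lagrangian_term ::
  "int \<Rightarrow> complex \<Rightarrow> complex^2^2 \<Rightarrow> real^(2 + 2)^(2 + 2) \<Rightarrow> (real^(2 + 2)^2) set \<Rightarrow> complex"
  where "lagrangian_term k s Z h L =
    scaling_weight k s (lagrangian_index h (row_basis L)) * eis_term k s Z (lag_det Z (row_basis L))"

lemma lagrangian_term_row_class:
  assumes "even k" "h \<in> Sp2_R" "g \<in> Sp2_Z"
  shows "lagrangian_term k s Z h (row_class (lower_half (g ** h))) =
    eis_term k s Z (aut_factor (g ** h) Z)"
proof -
  define P where "P = row_basis (row_class (lower_half (g ** h)))"
  obtain A where A: "det A \<noteq> 0" "P = A ** lower_half (g ** h)"
    using row_basis_in[of "lower_half (g ** h)"] unfolding P_def row_class_def by blast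
  obtain A' where A': "A' ** A = mat 1" "det A' = inverse (det A)"
    using det_nonzero_inverse[OF A(1)] by blast
  have eq: "lower_half (g ** h) = A' ** P"
    by (simp add: A matrix_mul_assoc A')
  have "is_lagrangian_index h P \<bar>det A'\<bar>"
    unfolding is_lagrangian_index_def
    by (rule bexI[OF _ assms(3)], rule exI[of _ A']) (use A A' eq in simp)
  then have "lagrangian_index h P = \<bar>det A'\<bar>"
    using assms(2) by (intro lagrangian_index_eqI)
  then show ?thesis
    unfolding lagrangian_term_def P_def[symmetric] unfolding aut_factor_eq eq lag_det_mult
      eis_term_scale[OF assms(1)] by simp
qed

text \<open>After cancelling \<open>h\<close>, an integral symplectic matrix is determined up to
  \<open>Sp2_Z0\<close> by the row space of its lower half.\<close>

lemma inj_on_row_class: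
  assumes "h \<in> Sp2_R"
  shows "inj_on (\<lambda>c. row_class (lower_half (coset_rep c ** h))) (left_cosets Sp2_Z0 Sp2_Z)"
proof (rule inj_onI)
  fix c d
  assume cd: "c \<in> left_cosets Sp2_Z0 Sp2_Z" "d \<in> left_cosets Sp2_Z0 Sp2_Z"
    and eq: "row_class (lower_half (coset_rep c ** h)) = row_class (lower_half (coset_rep d ** h))"
  obtain h' where h': "h ** h' = mat 1"
    using Sp2_R_has_inverse[OF assms] by blast
  obtain B where B: "det B \<noteq> 0" "lower_half (coset_rep d ** h) = B ** lower_half (coset_rep c ** h)"
    using row_class_self[of "lower_half (coset_rep d ** h)"] unfolding eq[symmetric]
    unfolding row_class_def by blast
  have "lower_half (coset_rep d ** h) ** h' = B ** lower_half (coset_rep c ** h) ** h'"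
    by (simp only: B(2))
  then have "lower_half (coset_rep d) = B ** lower_half (coset_rep c)"
    unfolding matrix_mul_assoc[symmetric] lower_half_mult[symmetric] h' matrix_mul_rid .
  then obtain p where "p \<in> Sp2_Z0" "coset_rep d = p ** coset_rep c"
    using same_row_space(1)[OF coset_rep_in_Sp2_Z[OF cd(1)] coset_rep_in_Sp2_Z[OF cd(2)] B(1)]
    by blast
  then show "c = d"
    using coset_image_eq[OF matrix_group_Sp2_Z0] coset_eq_rep[OF matrix_group_Sp2_Z0] cd by metis
qed

lemma lagrangian_term_eq_0:
  assumes "L \<in> range row_class"
    and "L \<notin> (\<lambda>c. row_class (lower_half (coset_rep c ** h))) ` left_cosets Sp2_Z0 Sp2_Z"
  shows "lagrangian_term k s Z h L = 0"
proof -
  have "\<not> is_lagrangian_index h (row_basis L) a" for a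
  proof
    assume "is_lagrangian_index h (row_basis L) a"
    then obtain \<gamma> A where \<gamma>: "\<gamma> \<in> Sp2_Z" "det A \<noteq> 0" "lower_half (\<gamma> ** h) = A ** row_basis L"
      unfolding is_lagrangian_index_def by blast
    define c where "c = (\<lambda>p. p ** \<gamma>) ` Sp2_Z0"
    have c: "c \<in> left_cosets Sp2_Z0 Sp2_Z"
      using \<gamma>(1) by (auto simp: c_def left_cosets_def)
    then have "coset_rep c \<in> c"
      by (rule coset_rep_in) (rule mat_1_in_Sp2_Z0)
    then obtain p where p: "p \<in> Sp2_Z0" "coset_rep c = p ** \<gamma>"
      by (auto simp: c_def)
    obtain B where B: "det B \<noteq> 0" "\<And>g. lower_half (p ** g) = B ** lower_half g"
      using lower_half_Sp2_Z0_mult[OF p(1)] by blast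
    have "lower_half (coset_rep c ** h) = B ** (A ** row_basis L)"
      unfolding p(2) matrix_mul_assoc[symmetric] B(2) \<gamma>(3) ..
    then have "row_class (lower_half (coset_rep c ** h)) = row_class (row_basis L)"
      using row_class_mult[OF B(1)] row_class_mult[OF \<gamma>(2)] by simp
    also have "\<dots> = L"
      using assms(1) row_class_basis by blast
    finally show False
      using assms(2) c by blast
  qed
  then show ?thesis
    by (simp add: lagrangian_term_def lagrangian_index_def)
qed

lemma has_sum_lagrangian_term:
  assumes "even k" "h \<in> Sp2_R"
  shows "(lagrangian_term k s Z h has_sum x) (range row_class) \<longleftrightarrow>
    ((\<lambda>c. eis_term k s Z (aut_factor (coset_rep c ** h) Z)) has_sum x) (left_cosets Sp2_Z0 Sp2_Z)"
proof -
  let ?\<phi> = "\<lambda>c. row_class (lower_half (coset_rep c ** h))" and ?S = "left_cosets Sp2_Z0 Sp2_Z"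
  have "(lagrangian_term k s Z h has_sum x) (range row_class) \<longleftrightarrow>
    (lagrangian_term k s Z h has_sum x) (?\<phi> ` ?S)"
    by (rule has_sum_cong_neutral) (auto intro: lagrangian_term_eq_0)
  also have "\<dots> \<longleftrightarrow> ((lagrangian_term k s Z h \<circ> ?\<phi>) has_sum x) ?S"
    by (rule has_sum_reindex[OF inj_on_row_class[OF assms(2)]])
  also have "\<dots> \<longleftrightarrow> ((\<lambda>c. eis_term k s Z (aut_factor (coset_rep c ** h) Z)) has_sum x) ?S"
    by (rule has_sum_cong) (simp add: lagrangian_term_row_class assms coset_rep_in_Sp2_Z)
  finally show ?thesis .
qed

section \<open>Hecke operators\<close>

lemma M_infty_det_pos:
  assumes "M \<in> M_infty"
  shows "det M > 0" "proportional_integral M"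
proof -
  obtain l n m where lnm: "l \<ge> 1" "n \<ge> 1" "m \<in> int_mats_det l" "M = mat (1 / real n) ** m"
    using assms unfolding M_infty_def by auto
  have M: "M = (1 / real n) *\<^sub>R m"
    unfolding lnm(4)
    by (cases m rule: mat2_cases) (simp add: mat_eq_mat2)
  have "det M = (1 / real n)\<^sup>2 * det m"
    unfolding M by (simp add: det_2 power2_eq_square algebra_simps)
  then have "det M = (1 / real n)\<^sup>2 * real l"
    using lnm(3) by (simp add: int_mats_det_def)
  then show "det M > 0"
    using lnm by simp
  show "proportional_integral M"
    unfolding M using lnm by (intro proportional_integral_scaleR) (auto simp: int_mats_det_def)
qed

lemma left_coset_SL2_Z_rep:
  assumes "c \<in> left_cosets SL2_Z M_infty"
  shows "det (coset_rep c) > 0" "proportional_integral (coset_rep c)"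
proof -
  obtain M where M: "M \<in> M_infty" "c = (\<lambda>\<gamma>. \<gamma> ** M) ` SL2_Z"
    using assms by (auto simp: left_cosets_def)
  have "coset_rep c \<in> c"
    using assms mat_1_in_SL2_Z by (rule coset_rep_in)
  then obtain \<gamma> where \<gamma>: "\<gamma> \<in> SL2_Z" "coset_rep c = \<gamma> ** M"
    using M by auto
  show "det (coset_rep c) > 0"
    using M_infty_det_pos(1)[OF M(1)] \<gamma> SL2_Z_det by (simp add: det_mul)
  show "proportional_integral (coset_rep c)"
    unfolding \<gamma>(2)
    by (rule proportional_integral_mult[OF integral_imp_proportional[OF SL2_Z_integral[OF \<gamma>(1)]]
          M_infty_det_pos(2)[OF M(1)]])
qed

lemma normalize_det:
  assumes "det M > 0"
  shows "det (normalize_det M) = 1"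
proof -
  have "det (normalize_det M) = (det M powr (- 1 / 2))\<^sup>2 * det M"
    by (simp add: normalize_det_def det_2 power2_eq_square algebra_simps)
  also have "(det M powr (- 1 / 2))\<^sup>2 = inverse (det M)"
    using assms by (simp add: powr_minus powr_half_sqrt power_inverse)
  finally show ?thesis
    using assms by simp
qed

lemma proportional_integral_normalize_det:
  assumes "det M > 0" "proportional_integral M"
  shows "proportional_integral (normalize_det M)"
proof -
  obtain r where "r \<noteq> 0" "integral_matrix (r *\<^sub>R M)"
    using assms by (auto simp: proportional_integral_def)
  then show ?thesis
    unfolding proportional_integral_def normalize_det_def using assms(1)
    by (intro exI[of _ "r / det M powr (- 1 / 2)"]) auto
qed

lemma normalize_det_mult:
  assumes "\<gamma> \<in> SL2_Z" "\<delta> \<in> SL2_Z"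
  shows "normalize_det (\<gamma> ** M ** \<delta>) = \<gamma> ** normalize_det M ** \<delta>"
  using assms
  by (simp add: normalize_det_def det_mul SL2_Z_det matrix_scalar_ac flip: scalar_matrix_assoc)

text \<open>A lattice basis of the plane has the components \<open>P1 ** M\<close> and
  \<open>P2 ** N\<close> with \<open>P1\<close> and \<open>P2\<close> integral. They are
  proportional to integral matrices by separate factors, which is why the normal form treats the two
  planes independently.\<close>

lemma is_index_swap:
  assumes "M \<in> {M. det M = 1 \<and> proportional_integral M}"
    and "N \<in> {M. det M = 1 \<and> proportional_integral M}"
    and "is_lagrangian_index (sp_times M N) P a"
  obtains B \<gamma> \<delta> where "\<bar>det B\<bar> = 1" "\<gamma> \<in> SL2_Z" "\<delta> \<in> SL2_Z"
    "P ** swap_planes = B ** P ** sp_times \<gamma> \<delta>"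
proof -
  obtain g A where g: "g \<in> Sp2_Z" "det A \<noteq> 0" "lower_half (g ** sp_times M N) = A ** P"
    using assms(3) unfolding is_lagrangian_index_def by blast
  have gR: "g \<in> Sp2_R" "integral_matrix g"
    using g(1) by (auto simp: Sp2_Z_def)
  have hR: "g ** sp_times M N \<in> Sp2_R"
    using gR(1) assms by (simp add: Sp2_R_mult sp_times_in_Sp2_R)
  obtain P1 P2 where PP: "lower_half g = interleave P1 P2" by (rule interleave_cases)
  have AP: "A ** P = interleave (P1 ** M) (P2 ** N)"
    by (simp add: lower_half_mult PP interleave_mult_sp_times flip: g(3))
  have "integral_matrix (block_C g)" "integral_matrix (block_D g)"
    using gR(2) by (auto simp: integral_matrix_def block_C_def block_D_def)
  moreover have "block_C g = mat2 (P1 $ 1 $ 1) (P2 $ 1 $ 1) (P1 $ 2 $ 1) (P2 $ 2 $ 1)"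
     "block_D g = mat2 (P1 $ 1 $ 2) (P2 $ 1 $ 2) (P1 $ 2 $ 2) (P2 $ 2 $ 2)"
    using PP by (simp_all add: lower_half_def interleave_def)
  ultimately have "integral_matrix P1" "integral_matrix P2"
    by (simp_all add: integral_matrix_def forall_2)
  then have "proportional_integral (P1 ** M)" "proportional_integral (P2 ** N)"
    using assms integral_imp_proportional proportional_integral_mult by blast+
  moreover have "det (P1 ** M) + det (P2 ** N) = 0"
    using interleave_lagrangian[OF gR(1) PP] assms by (simp add: det_mul)
  moreover have "X = 0" if "X ** interleave (P1 ** M) (P2 ** N) = 0" for X :: "real^2^2"
    using that lower_half_cancel[OF hR, of X 0] by (simp add: AP g(3))
  ultimately obtain B \<gamma> \<delta> where B: "\<bar>det B\<bar> = 1" "\<gamma> \<in> SL2_Z" "\<delta> \<in> SL2_Z"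
    "A ** P ** swap_planes = B ** (A ** P) ** sp_times \<gamma> \<delta>"
    unfolding AP using lagrangian_swap by blast
  obtain A' where A': "A' ** A = mat 1" "det A' = inverse (det A)"
    using det_nonzero_inverse[OF g(2)] by blast
  have "P ** swap_planes = A' ** A ** P ** swap_planes"
    by (simp add: A')
  also have "\<dots> = A' ** (A ** P ** swap_planes)"
    by (simp only: matrix_mul_assoc)
  also have "\<dots> = (A' ** B ** A) ** P ** sp_times \<gamma> \<delta>"
    unfolding B(4) by (simp only: matrix_mul_assoc)
  finally have "P ** swap_planes = (A' ** B ** A) ** P ** sp_times \<gamma> \<delta>" .
  moreover have "\<bar>det (A' ** B ** A)\<bar> = 1"
    using B(1) g(2) by (simp add: det_mul A' abs_mult abs_inverse)
  ultimately show thesis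
    using that B by blast
qed

text \<open>Applying the swap to lattice and plane turns \<open>up_bullet t\<close> into
  \<open>swap_planes ** down_bullet t\<close>, whose left factor does not affect the lattice.
  Undoing \<open>sp_times \<gamma> \<delta>\<close> on the plane puts the inverses on the lattice:
  the standard lattice of the first plane absorbs \<open>\<gamma>'\<close>, and
  \<open>\<delta>'\<close> is left to act on \<open>t\<close>.\<close>

lemma lagrangian_index_up_down:
  assumes "\<bar>det B\<bar> = 1" "\<gamma> \<in> SL2_Z" "P ** swap_planes = B ** P ** sp_times \<gamma> \<delta>"
    and "\<delta>' \<in> SL2_Z" "\<delta> ** \<delta>' = mat 1" "\<delta>' ** \<delta> = mat 1"
  shows "lagrangian_index (up_bullet t) P = lagrangian_index (down_bullet (t ** \<delta>')) P"
proof (rule lagrangian_index_cong)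
  obtain \<gamma>' where \<gamma>': "\<gamma>' \<in> SL2_Z" "\<gamma> ** \<gamma>' = mat 1" "\<gamma>' ** \<gamma> = mat 1"
    using SL2_Z_has_inverse[OF assms(2)] .
  let ?x = "sp_times \<gamma> \<delta>" and ?x' = "sp_times \<gamma>' \<delta>'"
  have x: "?x ** ?x' = mat 1" "?x' ** ?x = mat 1"
    by (simp_all add: sp_times_mult \<gamma>' assms sp_times_1)
  have "is_lagrangian_index (up_bullet t) P =
    is_lagrangian_index (up_bullet t ** swap_planes) (P ** swap_planes)"
    by (rule is_lagrangian_index_mult_right[OF swap_planes_sq, symmetric])
  also have "\<dots> = is_lagrangian_index (swap_planes ** down_bullet t) (B ** (P ** ?x))"
    by (simp only: up_bullet_def down_bullet_def sp_times_swap assms(3) matrix_mul_assoc)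
  also have "\<dots> = is_lagrangian_index (down_bullet t) (P ** ?x)"
    unfolding is_lagrangian_index_Sp2_Z_mult[OF swap_planes_in_Sp2_Z]
      is_lagrangian_index_mult_left[OF assms(1)] ..
  also have "\<dots> = is_lagrangian_index (down_bullet t ** ?x') (P ** ?x ** ?x')"
    by (rule is_lagrangian_index_mult_right[OF x(2), symmetric])
  also have "P ** ?x ** ?x' = P"
    unfolding matrix_mul_assoc[symmetric] x by simp
  also have "down_bullet t ** ?x' = sp_times \<gamma>' (mat 1) ** down_bullet (t ** \<delta>')"
    by (simp add: down_bullet_def sp_times_mult)
  also have "is_lagrangian_index \<dots> P = is_lagrangian_index (down_bullet (t ** \<delta>')) P"
    by (rule is_lagrangian_index_Sp2_Z_mult) (intro sp_times_in_Sp2_Z \<gamma>' mat_1_in_SL2_Z)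
  finally show "is_lagrangian_index (up_bullet t) P = is_lagrangian_index (down_bullet (t ** \<delta>')) P" .
qed

text \<open>The chosen representative of the translated coset and the translated representative
  differ by a left factor in \<open>SL2_Z\<close>, which preserves the lattice.\<close>

lemma lagrangian_index_down_coset:
  assumes "c \<in> left_cosets SL2_Z M_infty" "\<delta> \<in> SL2_Z"
    "(\<lambda>t. t ** \<delta>) ` c \<in> left_cosets SL2_Z M_infty"
  shows "lagrangian_index (down_bullet (normalize_det (coset_rep ((\<lambda>t. t ** \<delta>) ` c)))) P =
    lagrangian_index (down_bullet (normalize_det (coset_rep c) ** \<delta>)) P"
proof -
  let ?d = "(\<lambda>t. t ** \<delta>) ` c"
  have "coset_rep ?d \<in> ?d"
    using assms(3) mat_1_in_SL2_Z by (rule coset_rep_in)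
  then obtain t where t: "t \<in> c" "coset_rep ?d = t ** \<delta>"
    by blast
  then obtain \<gamma> where \<gamma>: "\<gamma> \<in> SL2_Z" "t = \<gamma> ** coset_rep c"
    using coset_eq_rep[OF matrix_group_SL2_Z assms(1)] by blast
  have "down_bullet (normalize_det (coset_rep ?d)) =
    sp_times (mat 1) \<gamma> ** down_bullet (normalize_det (coset_rep c) ** \<delta>)"
    unfolding t(2) \<gamma>(2) normalize_det_mult[OF \<gamma>(1) assms(2)]
    by (simp add: down_bullet_def sp_times_mult matrix_mul_assoc)
  then show ?thesis
    using is_lagrangian_index_Sp2_Z_mult[OF sp_times_in_Sp2_Z[OF mat_1_in_SL2_Z \<gamma>(1)]]
    by (intro lagrangian_index_cong) simp
qed

text \<open>If no coset makes the plane rational, all indices are \<open>0\<close> and both sums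
  vanish by \<open>w 0 = 0\<close>. Otherwise a single such coset, on either side, yields the pair
  (\<gamma>, \<delta>), and translating every coset by the inverse of \<delta> matches the two sums,
  because the coefficients of \<open>T\<close> are invariant.\<close>

lemma hecke_weights_up_down:
  fixes w :: "real \<Rightarrow> complex"
  assumes "T \<in> carrier hecke_algebra" "w 0 = 0"
  shows "(\<Sum>c\<in>Poly_Mapping.keys T. of_rat (Poly_Mapping.lookup T c) *
      w (lagrangian_index (up_bullet (normalize_det (coset_rep c))) P)) =
    (\<Sum>c\<in>Poly_Mapping.keys T. of_rat (Poly_Mapping.lookup T c) *
      w (lagrangian_index (down_bullet (normalize_det (coset_rep c))) P))"
    (is "(\<Sum>c\<in>?K. ?a c * w (?u c)) = (\<Sum>c\<in>?K. ?a c * w (?d c))")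
proof (cases "\<exists>c\<in>?K. \<exists>a. is_lagrangian_index (up_bullet (normalize_det (coset_rep c))) P a \<or>
    is_lagrangian_index (down_bullet (normalize_det (coset_rep c))) P a")
  case False
  then have "?u c = 0" "?d c = 0" if "c \<in> ?K" for c
    using that by (auto simp: lagrangian_index_def)
  then show ?thesis
    using assms(2) by simp
next
  case True
  have K: "?K \<subseteq> left_cosets SL2_Z M_infty"
    and inv: "\<And>\<gamma> c. \<gamma> \<in> SL2_Z \<Longrightarrow> c \<in> left_cosets SL2_Z M_infty \<Longrightarrow>
      Poly_Mapping.lookup T ((\<lambda>t. t ** \<gamma>) ` c) = Poly_Mapping.lookup T c"
    using assms(1) by (auto simp: hecke_algebra_def)
  obtain c a where c: "c \<in> ?K" and
    ca: "is_lagrangian_index (up_bullet (normalize_det (coset_rep c))) P a \<or>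
      is_lagrangian_index (down_bullet (normalize_det (coset_rep c))) P a"
    using True by blast
  let ?W = "{M :: real^2^2. det M = 1 \<and> proportional_integral M}"
  have t: "normalize_det (coset_rep c) \<in> ?W"
    using c K left_coset_SL2_Z_rep normalize_det proportional_integral_normalize_det by auto
  have e: "mat 1 \<in> ?W"
    by (simp add: integral_imp_proportional integral_matrix_mat)
  have "\<exists>B \<gamma> \<delta>. \<bar>det B\<bar> = 1 \<and> \<gamma> \<in> SL2_Z \<and> \<delta> \<in> SL2_Z \<and>
    P ** swap_planes = B ** P ** sp_times \<gamma> \<delta>"
    using ca unfolding up_bullet_def down_bullet_def
    by (elim disjE) (rule is_index_swap[OF t e], assumption, blast,
        rule is_index_swap[OF e t], assumption, blast)
  then obtain B \<gamma> \<delta> where B: "\<bar>det B\<bar> = 1" "\<gamma> \<in> SL2_Z" "\<delta> \<in> SL2_Z"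
    "P ** swap_planes = B ** P ** sp_times \<gamma> \<delta>"
    by blast
  obtain \<delta>' where d: "\<delta>' \<in> SL2_Z" "\<delta> ** \<delta>' = mat 1" "\<delta>' ** \<delta> = mat 1"
    using SL2_Z_has_inverse[OF B(3)] .
  let ?f = "\<lambda>\<delta> c. (\<lambda>t. t ** \<delta>) ` c :: (real^2^2) set"
  have ff: "?f \<delta> (?f \<delta>' c) = c" "?f \<delta>' (?f \<delta> c) = c" for c
    by (simp_all add: image_image d flip: matrix_mul_assoc)
  have fK: "?f \<epsilon> c \<in> ?K" if "\<epsilon> \<in> SL2_Z" "c \<in> ?K" for \<epsilon> c
    using inv[OF that(1)] that(2) K by (auto simp: in_keys_iff)
  show ?thesis
  proof (rule sum.reindex_bij_witness[of _ "?f \<delta>" "?f \<delta>'"])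
    fix c assume c: "c \<in> ?K"
    show fc: "?f \<delta>' c \<in> ?K"
      by (rule fK[OF d(1) c])
    have cl: "c \<in> left_cosets SL2_Z M_infty" "?f \<delta>' c \<in> left_cosets SL2_Z M_infty"
      using c fc K by auto
    have "?d (?f \<delta>' c) = ?u c"
      unfolding lagrangian_index_down_coset[OF cl(1) d(1) cl(2)]
      by (rule lagrangian_index_up_down[OF B(1,2,4) d, symmetric])
    moreover have "Poly_Mapping.lookup T (?f \<delta>' c) = Poly_Mapping.lookup T c"
      by (rule inv[OF d(1) cl(1)])
    ultimately show "?a (?f \<delta>' c) * w (?d (?f \<delta>' c)) = ?a c * w (?u c)"
      by simp
  qed (rule ff | rule fK[OF B(3)], assumption)+
qed

lemma has_sum_finite_sum:
  fixes f :: "'i \<Rightarrow> 'a \<Rightarrow> complex"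
  assumes "finite I" "\<And>i. i \<in> I \<Longrightarrow> (f i has_sum x i) A"
  shows "((\<lambda>a. \<Sum>i\<in>I. f i a) has_sum (\<Sum>i\<in>I. x i)) A"
  using assms by (induction rule: finite_induct) (auto intro: has_sum_0 has_sum_add)

theorem theorem4p3:
  fixes k :: int and T :: formal_coset_sum and Z :: "complex^2^2" and s :: complex
  assumes "even k"
    and "T \<in> carrier hecke_algebra"
    and "Z \<in> siegel_H2"
    and "2 * Re s + of_int k > 3"
  shows "bowtie k (eisenstein k s) T Z = 0"
proof -
  let ?K = "Poly_Mapping.keys T" and ?a = "\<lambda>c. of_rat (Poly_Mapping.lookup T c) :: complex"
  let ?S = "left_cosets Sp2_Z0 Sp2_Z"
  let ?E = "\<lambda>h c. eis_term k s Z (aut_factor (coset_rep c ** h) Z)"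
  have "det (normalize_det (coset_rep c)) = 1" if "c \<in> ?K" for c
    using that assms(2) left_coset_SL2_Z_rep(1) normalize_det by (auto simp: hecke_algebra_def)
  then have Sp: "up_bullet (normalize_det (coset_rep c)) \<in> Sp2_R"
    "down_bullet (normalize_det (coset_rep c)) \<in> Sp2_R" if "c \<in> ?K" for c
    using that by (simp_all add: up_bullet_def down_bullet_def sp_times_in_Sp2_R)
  have summable: "?E h summable_on ?S \<longleftrightarrow> ?E (mat 1) summable_on ?S" if "h \<in> Sp2_R" for h
    using summable_slash_eisenstein[OF assms(1) that assms(3)] by simp
  have "hecke_up k (eisenstein k s) T Z = hecke_down k (eisenstein k s) T Z"
  proof (cases "?E (mat 1) summable_on ?S")
    case False
    then have "slash k (eisenstein k s) h Z = 0" if "h \<in> Sp2_R" for h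
      using slash_eisenstein[OF that assms(3)] summable[OF that] by (simp add: infsum_not_exists)
    then show ?thesis
      using Sp by (simp add: hecke_up_def hecke_down_def)
  next
    case True
    have *: "(lagrangian_term k s Z h has_sum slash k (eisenstein k s) h Z) (range row_class)"
      if "h \<in> Sp2_R" for h
      unfolding has_sum_lagrangian_term[OF assms(1) that] slash_eisenstein[OF that assms(3)]
      using summable[OF that] True by (simp add: has_sum_infsum)
    have sum: "((\<lambda>L. \<Sum>c\<in>?K. ?a c * lagrangian_term k s Z (h c) L) has_sum
      (\<Sum>c\<in>?K. ?a c * slash k (eisenstein k s) (h c) Z)) (range row_class)"
      if "\<And>c. c \<in> ?K \<Longrightarrow> h c \<in> Sp2_R" for h
      using * that by (intro has_sum_finite_sum has_sum_cmult_right) auto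
    \<comment> \<open>Only the index depends on the coset; for a fixed plane the term is a function
      of the index that vanishes at \<open>0\<close>.\<close>
    let ?w = "\<lambda>L a. scaling_weight k s a * eis_term k s Z (lag_det Z (row_basis L))"
    have eq: "(\<Sum>c\<in>?K. ?a c * lagrangian_term k s Z (up_bullet (normalize_det (coset_rep c))) L) =
      (\<Sum>c\<in>?K. ?a c * lagrangian_term k s Z (down_bullet (normalize_det (coset_rep c))) L)" for L
      unfolding lagrangian_term_def
      by (rule hecke_weights_up_down[where w = "?w L", OF assms(2)]) simp
    show ?thesis
      unfolding hecke_up_def hecke_down_def
      by (rule has_sum_unique
        [OF sum[of "\<lambda>c. up_bullet (normalize_det (coset_rep c))", OF Sp(1), unfolded eq]
            sum[of "\<lambda>c. down_bullet (normalize_det (coset_rep c))", OF Sp(2)]])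
  qed
  then show ?thesis
    by (simp add: bowtie_def)
qed

end
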